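(* Let $L>0$ and let $S^d_{++}$ be the set of symmetric positive definite $d\times d$ real matrices whose eigenvalues all lie in $(0,L]$. Let $(M_i,N_i)$, $i=1,\dots,N$, be i.i.d. pairs of covariance matrices generated by $$N_i=Q_{\epsilon_i}T_0M_iT_0Q_{\epsilon_i},$$ where the random matrices $M_i$ and the fixed matrix $T_0$ belong to $S^d_{++}$, and the $Q_{\epsilon_i}$ are i.i.d. random matrices in $S^d_{++}$, independent of the $M_i$, with $\mathbb{E}(Q_{\epsilon_i})=I$. Let $\hat T_N$ be a minimizer over $T\in S^d_{++}$ of $$M_N(T)=\sum_{i=1}^N\Big[\operatorname{tr}(TM_iT)+\operatorname{tr}(N_i)-2\operatorname{tr}\big((N_i^{1/2}TM_iTN_i^{1/2})^{1/2}\big)\Big].$$ Then, as $N\to\infty$, $$N^{1/2}\rho(\hat T_N,T_0)=O_{\mathbb{P}}(1).$$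
   Context: The matrices $M_i,N_i$ represent the centred Gaussian regressor and response measures $\mu_i=N(0,M_i)$ and $\nu_i=N(0,N_i)$ on $\mathbb{R}^d$. A matrix $T\in S^d_{++}$ is identified with the linear optimal transport map $x\mapsto Tx$, so that $T\#N(0,M)=N(0,TMT)$. The 2-Wasserstein distance between centred Gaussians is $d^2_{\mathcal{W}}(N(0,A),N(0,B))=\operatorname{tr}(A)+\operatorname{tr}(B)-2\operatorname{tr}\big((B^{1/2}AB^{1/2})^{1/2}\big)$, hence $M_N(T)=\sum_i d^2_{\mathcal{W}}(T\#\mu_i,\nu_i)$. The semi-metric $\rho$ is $$\rho(T_1,T_2)=\Big[\int d^2_{\mathcal{W}}(T_1\#\mu,T_2\#\mu)\,\mathrm{d}P_M(\mu)\Big]^{1/2},$$ where $P_M$ is the law of the random Gaussian measure $\mu=N(0,M_1)$. $X_N=O_{\mathbb{P}}(1)$ means that the sequence $X_N$ is bounded in probability. *)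

theory Defs
  imports "HOL-Probability.Probability"
begin

definition symmetric_matrix :: "real^'d^'d \<Rightarrow> bool" where
  "symmetric_matrix A \<longleftrightarrow> transpose A = A"

definition pos_def :: "real^'d^'d \<Rightarrow> bool" where
  "pos_def A \<longleftrightarrow> symmetric_matrix A \<and> (\<forall>x. x \<noteq> 0 \<longrightarrow> 0 < x \<bullet> (A *v x))"

definition pos_semidef :: "real^'d^'d \<Rightarrow> bool" where
  "pos_semidef A \<longleftrightarrow> symmetric_matrix A \<and> (\<forall>x. 0 \<le> x \<bullet> (A *v x))"

text \<open>Only used for symmetric matrices, all of whose eigenvalues are real.\<close>

definition is_eigenvalue :: "real^'d^'d \<Rightarrow> real \<Rightarrow> bool" where
  "is_eigenvalue A c \<longleftrightarrow> (\<exists>v. v \<noteq> 0 \<and> A *v v = c *\<^sub>R v)"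

definition spd_set :: "real \<Rightarrow> (real^'d^'d) set" where
  "spd_set L = {A. pos_def A \<and> (\<forall>c. is_eigenvalue A c \<longrightarrow> 0 < c \<and> c \<le> L)}"

text \<open>The unique positive semidefinite square root; unspecified if \<open>A\<close> is not
  positive semidefinite.\<close>

definition mat_sqrt :: "real^'d^'d \<Rightarrow> real^'d^'d" where
  "mat_sqrt A = (THE R. pos_semidef R \<and> R ** R = A)"

text \<open>\<open>N(0, A)\<close> is the law of \<open>sqrt(A) Z\<close>, where \<open>Z\<close> has independent standard normal
  components.\<close>

definition centred_gaussian :: "real^'d^'d \<Rightarrow> (real^'d) measure" where
  "centred_gaussian A =
     distr (PiM (UNIV :: 'd set) (\<lambda>_. density lborel (\<lambda>t. ennreal (std_normal_density t)))) borel
       (\<lambda>z. mat_sqrt A *v (\<chi> i. z i))"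

definition linear_push :: "real^'d^'d \<Rightarrow> (real^'d) measure \<Rightarrow> (real^'d) measure" where
  "linear_push T \<mu> = distr \<mu> borel (\<lambda>x. T *v x)"

definition couplings :: "(real^'d) measure \<Rightarrow> (real^'d) measure \<Rightarrow> ((real^'d) \<times> (real^'d)) measure set" where
  "couplings \<mu> \<nu> = {\<pi>. prob_space \<pi> \<and> sets \<pi> = sets (borel \<Otimes>\<^sub>M borel) \<and>
     distr \<pi> borel fst = \<mu> \<and> distr \<pi> borel snd = \<nu>}"

text \<open>The 2-Wasserstein distance; \<open>enn2real\<close> loses nothing for measures with finite second
  moments, in particular for Gaussians.\<close>

definition wasserstein2 :: "(real^'d) measure \<Rightarrow> (real^'d) measure \<Rightarrow> real" where
  "wasserstein2 \<mu> \<nu> =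
     sqrt (enn2real (INF \<pi>\<in>couplings \<mu> \<nu>. \<integral>\<^sup>+ z. ennreal ((dist (fst z) (snd z))\<^sup>2) \<partial>\<pi>))"

text \<open>The random Gaussian measure \<open>\<mu> = N(0, M)\<close> is represented by its covariance matrix: \<open>P\<close>
  is the law of the random matrix \<open>M\<close>, and the integral over the law of \<open>\<mu>\<close> is the
  integral over \<open>P\<close>.\<close>

definition rho :: "(real^'d^'d) measure \<Rightarrow> real^'d^'d \<Rightarrow> real^'d^'d \<Rightarrow> real" where
  "rho P T1 T2 =
     sqrt (\<integral>A. (wasserstein2 (linear_push T1 (centred_gaussian A))
                          (linear_push T2 (centred_gaussian A)))\<^sup>2 \<partial>P)"

text \<open>Samples are indexed from \<open>0\<close>, so that the first \<open>n\<close> are those with index \<open>i < n\<close>.\<close>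

definition objective ::
  "(nat \<Rightarrow> real^'d^'d) \<Rightarrow> (nat \<Rightarrow> real^'d^'d) \<Rightarrow> nat \<Rightarrow> real^'d^'d \<Rightarrow> real" where
  "objective M N n T =
     (\<Sum>i<n. trace (T ** M i ** T) + trace (N i)
        - 2 * trace (mat_sqrt (mat_sqrt (N i) ** T ** M i ** T ** mat_sqrt (N i))))"

definition iid :: "'w measure \<Rightarrow> 'b measure \<Rightarrow> (nat \<Rightarrow> 'w \<Rightarrow> 'b) \<Rightarrow> bool" where
  "iid \<Omega> S X \<longleftrightarrow> prob_space.indep_vars \<Omega> (\<lambda>_. S) X UNIV \<and>
     (\<forall>i. distr \<Omega> S (X i) = distr \<Omega> S (X 0))"

definition bounded_in_prob :: "'w measure \<Rightarrow> (nat \<Rightarrow> 'w \<Rightarrow> real) \<Rightarrow> bool" where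
  "bounded_in_prob \<Omega> X \<longleftrightarrow>
     (\<forall>\<epsilon>>0. \<exists>K. \<forall>n. measure \<Omega> {\<omega> \<in> space \<Omega>. \<bar>X n \<omega>\<bar> > K} \<le> \<epsilon>)"

end

theory Submission
  imports Defs
begin

text \<open>
  Write \<open>A = T M T\<close>, \<open>A0 = T0 M T0\<close>, \<open>N = Q A0 Q\<close>, and let \<open>Z\<close> be the optimal map from \<open>A\<close> to \<open>N\<close>, so that
  \<open>Z A Z = N\<close>. Since \<open>Q\<close> is the optimal map from \<open>A0\<close> to \<open>N\<close>, the loss difference between \<open>T\<close> and \<open>T0\<close> is
  exactly \<open>tr((I - Q)(A - A0)) + tr(A (Q - Z) Q\<^sup>-\<^sup>1 (Q - Z))\<close>. The second term is nonnegative, and it is at least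
  \<open>\<kappa> |T - T0|\<^sup>2\<close> when the smallest eigenvalues of \<open>M\<close>, \<open>Q\<close> and \<open>T0\<close> are at least \<open>\<delta>\<close>, which by Markov's inequality
  holds for at least half of the sample with high probability once \<open>\<delta>\<close> is small. The first term is linear in
  the entries of \<open>(I - Q) \<otimes> M\<close>, whose sums over the sample consist of centred uncorrelated bounded variables and
  are \<open>O(sqrt n)\<close> by Chebyshev, uniformly in \<open>T\<close>; no empirical process theory is needed. At a minimizer this
  gives \<open>n |T - T0|\<^sup>2 \<le> C sqrt n |T - T0|\<close>, and coupling through a common Gaussian vector gives
  \<open>\<rho>(T, T0) \<le> C |T - T0|\<close>.
\<close>

section \<open>Symmetric matrices and positive semidefinite square roots\<close>

text \<open>The interpretation that follows turns bilinearity into the rewrite rules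
  \<open>matrix_mult.diff_left\<close>, \<open>matrix_mult.diff_right\<close> and
  \<open>matrix_mult.scaleR_left\<close>, used throughout.\<close>

lemma bounded_bilinear_matrix_mult: "bounded_bilinear ((**) :: real^'n^'m \<Rightarrow> real^'k^'n \<Rightarrow> real^'k^'m)"
proof -
  have "bilinear ((**) :: real^'n^'m \<Rightarrow> real^'k^'n \<Rightarrow> real^'k^'m)"
    unfolding bilinear_def
    by (auto intro!: linearI simp: matrix_matrix_mult_def vec_eq_iff sum.distrib sum_distrib_left algebra_simps)
  then show ?thesis by (simp add: bilinear_conv_bounded_bilinear)
qed

interpretation matrix_mult: bounded_bilinear "(**) :: real^'n^'m \<Rightarrow> real^'k^'n \<Rightarrow> real^'k^'m"
  by (rule bounded_bilinear_matrix_mult)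

lemma trace_scaleR: "trace (c *\<^sub>R (A::real^'n^'n)) = c * trace A"
  by (simp add: trace_def sum_distrib_left)

text \<open>Identifies the inherited Euclidean norm on nested vectors as the Frobenius norm, so that
  Cauchy-Schwarz bounds traces.\<close>

lemma inner_matrix_eq_trace: "(A::real^'n^'m) \<bullet> B = trace (transpose A ** B)"
proof -
  have "trace (transpose A ** B) = (\<Sum>i\<in>UNIV. \<Sum>k\<in>UNIV. A$k$i * B$k$i)"
    by (simp add: trace_def matrix_matrix_mult_def transpose_def)
  also have "\<dots> = (\<Sum>k\<in>UNIV. \<Sum>i\<in>UNIV. A$k$i * B$k$i)" by (rule sum.swap)
  finally show ?thesis by (simp add: inner_vec_def)
qed

lemma norm_matrix_power2: "(norm (A::real^'n^'m))\<^sup>2 = trace (transpose A ** A)"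
  by (simp add: power2_norm_eq_inner inner_matrix_eq_trace)

lemma norm_transpose_matrix: "norm (transpose (A::real^'n^'m)) = norm A"
proof -
  have "(norm (transpose A))\<^sup>2 = (norm A)\<^sup>2"
    unfolding norm_matrix_power2 by (simp add: trace_mul_sym[of A])
  then show ?thesis by simp
qed

lemma norm_matrix_vector_mult_le: "norm ((A::real^'n^'m) *v x) \<le> norm A * norm x"
proof -
  have "norm (A *v x) \<le> L2_set (\<lambda>i. norm (A$i) * norm x) UNIV"
    unfolding norm_vec_def[of "A *v x"]
    by (rule L2_set_mono) (auto simp: matrix_vector_mul_component Cauchy_Schwarz_ineq2)
  also have "\<dots> = norm A * norm x"
    by (simp add: norm_vec_def[of A] L2_set_left_distrib)
  finally show ?thesis .
qed

text \<open>Row \<open>i\<close> of the product is \<open>transpose B\<close> applied to row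
  \<open>i\<close> of \<open>A\<close>, so the matrix-vector bound applies row by row.\<close>

lemma norm_matrix_mult_le: "norm ((A::real^'n^'m) ** (B::real^'k^'n)) \<le> norm A * norm B"
proof -
  have "norm (A ** B) \<le> L2_set (\<lambda>i. norm (A$i) * norm B) UNIV"
    unfolding norm_vec_def[of "A ** B"]
  proof (rule L2_set_mono)
    fix i
    have "(A ** B)$i = transpose B *v (A$i)"
      by (simp add: vec_eq_iff matrix_matrix_mult_def vector_matrix_mult_def mult.commute)
    then show "norm ((A ** B)$i) \<le> norm (A$i) * norm B"
      using norm_matrix_vector_mult_le[of "transpose B" "A$i"]
      by (simp add: norm_transpose_matrix mult.commute del: transpose_matrix_vector)
  qed simp
  also have "\<dots> = norm A * norm B"
    by (simp add: norm_vec_def[of A] L2_set_left_distrib)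
  finally show ?thesis .
qed

section \<open>Spectral theorem for symmetric matrices\<close>

lemma symmetric_matrix_inner:
  "symmetric_matrix A \<Longrightarrow> x \<bullet> (A *v y) = (A *v x) \<bullet> y"
  by (metis dot_lmul_matrix symmetric_matrix_def transpose_matrix_vector)

text \<open>Along \<open>v + t w\<close> the form is a polynomial in \<open>t\<close> without
  constant term; being nonnegative for both signs of \<open>t\<close>, it has no linear term either.
  The restriction to a subspace serves the induction for the spectral theorem.\<close>

lemma psd_kernel:
  assumes sym: "symmetric_matrix B" and S: "subspace S"
    and nonneg: "\<And>x. x \<in> S \<Longrightarrow> 0 \<le> x \<bullet> (B *v x)"
    and v: "v \<in> S" "v \<bullet> (B *v v) = 0" and w: "w \<in> S"
  shows "w \<bullet> (B *v v) = 0"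
proof (rule ccontr)
  assume *: "w \<bullet> (B *v v) \<noteq> 0"
  define b where "b = w \<bullet> (B *v v)"
  define c where "c = w \<bullet> (B *v w)"
  have c0: "c \<ge> 0" using nonneg[OF w] by (simp add: c_def)
  have q: "0 \<le> 2 * t * b + t\<^sup>2 * c" for t
  proof -
    have "v + t *\<^sub>R w \<in> S" using S v w by (simp add: subspace_add subspace_scale)
    from nonneg[OF this] have "0 \<le> (v + t *\<^sub>R w) \<bullet> (B *v (v + t *\<^sub>R w))" .
    also have "\<dots> = 2 * t * b + t\<^sup>2 * c"
      using v(2) symmetric_matrix_inner[OF sym, of v w]
      by (simp add: b_def c_def inner_add_left inner_add_right algebra_simps
          matrix_vector_mult_scaleR power2_eq_square inner_commute)
    finally show ?thesis .
  qed
  \<comment> \<open>The denominator is \<open>c + 1\<close> rather than \<open>c\<close> because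
    \<open>c\<close> may vanish.\<close>
  have "0 \<le> 2 * (- b / (c + 1)) * b + (- b / (c + 1))\<^sup>2 * c" by (rule q)
  also have "\<dots> = - b\<^sup>2 * (c + 2) / (c + 1)\<^sup>2"
    using c0 by (simp add: power2_eq_square divide_simps) (simp add: algebra_simps)
  also have "\<dots> < 0"
    using c0 * by (auto simp: b_def divide_neg_pos)
  finally show False by simp
qed

lemma transpose_add_matrix: "transpose (A + B) = transpose A + transpose B"
  by (simp add: transpose_def vec_eq_iff)

lemma transpose_diff_matrix: "transpose (A - B) = transpose A - transpose B"
  by (simp add: transpose_def vec_eq_iff)

lemma symmetric_matrix_algebra:
  "symmetric_matrix (mat c)"
  "symmetric_matrix A \<Longrightarrow> symmetric_matrix B \<Longrightarrow> symmetric_matrix (A + B)"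
  "symmetric_matrix A \<Longrightarrow> symmetric_matrix B \<Longrightarrow> symmetric_matrix (A - B)"
  "symmetric_matrix A \<Longrightarrow> symmetric_matrix (r *\<^sub>R A)"
  "symmetric_matrix A \<Longrightarrow> symmetric_matrix (transpose X ** A ** X)"
  "symmetric_matrix A \<Longrightarrow> symmetric_matrix X \<Longrightarrow> symmetric_matrix (X ** A ** X)"
  by (simp_all add: symmetric_matrix_def matrix_transpose_mul matrix_mul_assoc[symmetric] transpose_scalar
      transpose_add_matrix transpose_diff_matrix)

lemma mat_scaleR_vector: "mat c *v x = c *\<^sub>R (x::real^'n)"
  by (simp add: matrix_vector_mult_def mat_def vec_eq_iff if_distribR if_distrib[of "\<lambda>a. a * _"] cong: if_cong)

text \<open>The Rayleigh quotient attains its maximum \<open>c\<close> on the compact unit sphere of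
  \<open>S\<close>. The form of \<open>mat c - A\<close> is then nonnegative on \<open>S\<close> and
  zero at the maximizer \<open>v\<close>, so \<open>psd_kernel\<close>, tested against
  \<open>(mat c - A) *v v\<close>, which lies in \<open>S\<close> by invariance, makes
  \<open>v\<close> an eigenvector.\<close>

lemma Rayleigh_maximum:
  fixes A :: "real^'d^'d"
  assumes sym: "symmetric_matrix A" and S: "subspace S" "S \<noteq> {0}"
    and inv: "\<And>x. x \<in> S \<Longrightarrow> A *v x \<in> S"
  obtains v c where "v \<in> S" "norm v = 1" "A *v v = c *\<^sub>R v"
    "\<And>x. x \<in> S \<Longrightarrow> x \<bullet> (A *v x) \<le> c * (x \<bullet> x)"
proof -
  let ?K = "sphere 0 1 \<inter> S"
  obtain u where u: "u \<in> S" "u \<noteq> 0" using S subspace_0 by blast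
  then have "(1 / norm u) *\<^sub>R u \<in> ?K" using S by (simp add: subspace_scale)
  then have ne: "?K \<noteq> {}" by blast
  have cp: "compact ?K" by (intro compact_Int_closed closed_subspace S compact_sphere)
  have "continuous_on ?K (\<lambda>x. x \<bullet> (A *v x))"
    by (intro continuous_intros linear_continuous_on matrix_vector_mul_bounded_linear)
  from continuous_attains_sup[OF cp ne this] obtain v where
    v: "v \<in> ?K" and mx: "\<And>x. x \<in> ?K \<Longrightarrow> x \<bullet> (A *v x) \<le> v \<bullet> (A *v v)" by blast
  define c where "c = v \<bullet> (A *v v)"
  have le: "x \<bullet> (A *v x) \<le> c * (x \<bullet> x)" if "x \<in> S" for x
  proof (cases "x = 0")
    case False
    then have "(1 / norm x) *\<^sub>R x \<in> ?K" using S that by (simp add: subspace_scale)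
    from mx[OF this] have "(x \<bullet> (A *v x)) / (norm x)\<^sup>2 \<le> c"
      by (simp add: c_def matrix_vector_mult_scaleR power2_eq_square)
    then show ?thesis using False by (simp add: divide_le_eq power2_norm_eq_inner)
  qed simp
  define B where "B = mat c - A"
  have symB: "symmetric_matrix B" unfolding B_def by (intro symmetric_matrix_algebra sym)
  have Bx: "B *v x = c *\<^sub>R x - A *v x" for x
    by (simp add: B_def matrix_vector_mult_diff_rdistrib mat_scaleR_vector)
  have vS: "v \<in> S" and nv: "norm v = 1" using v by auto
  have "v \<bullet> (B *v v) = 0" using nv by (simp add: Bx inner_diff_right c_def norm_eq_1)
  moreover have "0 \<le> x \<bullet> (B *v x)" if "x \<in> S" for x
    using le[OF that] by (simp add: Bx inner_diff_right)
  moreover have "B *v v \<in> S" unfolding Bx using S vS inv by (simp add: subspace_diff subspace_scale)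
  ultimately have "(B *v v) \<bullet> (B *v v) = 0"
    using psd_kernel[OF symB S(1), of v "B *v v"] vS by blast
  then have "A *v v = c *\<^sub>R v" by (simp add: Bx)
  then show ?thesis using that vS nv le by blast
qed

text \<open>Induction on the dimension: split off a unit eigenvector \<open>v\<close>; its
  orthogonal complement inside \<open>S\<close> is again invariant because \<open>A\<close> is
  symmetric.\<close>

lemma symmetric_orthonormal_eigenbasis:
  fixes A :: "real^'d^'d"
  assumes sym: "symmetric_matrix A"
  shows "subspace S \<Longrightarrow> (\<And>x. x \<in> S \<Longrightarrow> A *v x \<in> S) \<Longrightarrow>
    \<exists>B. finite B \<and> B \<subseteq> S \<and> pairwise orthogonal B \<and> (\<forall>b\<in>B. norm b = 1 \<and> (\<exists>c. A *v b = c *\<^sub>R b)) \<and>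
      (\<forall>x\<in>S. x = (\<Sum>b\<in>B. (b \<bullet> x) *\<^sub>R b))"
proof (induction "dim S" arbitrary: S rule: less_induct)
  case less
  show ?case
  proof (cases "S = {0}")
    case True
    then show ?thesis by (intro exI[of _ "{}"]) auto
  next
    case False
    obtain v c where v: "v \<in> S" "norm v = 1" "A *v v = c *\<^sub>R v"
      using Rayleigh_maximum[OF sym less.prems(1) False less.prems(2)] by metis
    define S' where "S' = {x \<in> S. v \<bullet> x = 0}"
    have sub': "subspace S'"
      using less.prems(1) unfolding S'_def subspace_def by (auto simp: inner_add_right)
    have inv': "A *v x \<in> S'" if "x \<in> S'" for x
      using that less.prems(2) v symmetric_matrix_inner[OF sym, of v x]
      by (auto simp: S'_def)
    have vn: "v \<notin> S'" using v by (auto simp: S'_def norm_eq_1)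
    have "S' \<subseteq> S" by (auto simp: S'_def)
    then have "dim S' < dim S"
      using dim_subset[of S' S] dim_eq_span[of S' S] sub' less.prems(1) vn v(1)
      by (metis le_neq_implies_less order_refl span_eq_iff)
    from less.hyps[OF this sub' inv'] obtain B where
      B: "finite B" "B \<subseteq> S'" "pairwise orthogonal B"
        "\<forall>b\<in>B. norm b = 1 \<and> (\<exists>c. A *v b = c *\<^sub>R b)"
        "\<And>x. x \<in> S' \<Longrightarrow> x = (\<Sum>b\<in>B. (b \<bullet> x) *\<^sub>R b)" by blast
    have "x = (\<Sum>b\<in>insert v B. (b \<bullet> x) *\<^sub>R b)" if "x \<in> S" for x
    proof -
      let ?y = "x - (v \<bullet> x) *\<^sub>R v"
      have "?y \<in> S'"
        using that v less.prems(1)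
        by (simp add: S'_def subspace_diff subspace_scale inner_diff_right norm_eq_1)
      from B(5)[OF this] have "?y = (\<Sum>b\<in>B. (b \<bullet> ?y) *\<^sub>R b)" .
      also have "\<dots> = (\<Sum>b\<in>B. (b \<bullet> x) *\<^sub>R b)"
        using B(2) by (intro sum.cong refl) (auto simp: S'_def inner_diff_right inner_commute)
      finally show ?thesis using vn B(1,2)
        by (subst sum.insert) (auto simp: algebra_simps)
    qed
    moreover have "pairwise orthogonal (insert v B)"
      using B(2,3) by (auto simp: pairwise_insert S'_def orthogonal_def inner_commute)
    ultimately show ?thesis using B v \<open>S' \<subseteq> S\<close>
      by (intro exI[of _ "insert v B"]) auto
  qed
qed

lemma symmetric_matrix_eigenbasis:
  fixes A :: "real^'d^'d"
  assumes sym: "symmetric_matrix A"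
  shows "\<exists>B c. finite B \<and> pairwise orthogonal B \<and> (\<forall>b\<in>B. norm b = 1 \<and> A *v b = c b *\<^sub>R b) \<and>
    (\<forall>x. x = (\<Sum>b\<in>B. (b \<bullet> x) *\<^sub>R b))"
proof -
  obtain B where B: "finite B" "pairwise orthogonal B" "\<forall>b\<in>B. norm b = 1 \<and> (\<exists>c. A *v b = c *\<^sub>R b)"
      "\<forall>x\<in>UNIV. x = (\<Sum>b\<in>B. (b \<bullet> x) *\<^sub>R b)"
    using symmetric_orthonormal_eigenbasis[OF sym subspace_UNIV] by blast
  have "A *v b = (b \<bullet> (A *v b)) *\<^sub>R b" if "b \<in> B" for b
    using B(3) that by (auto simp: norm_eq_1)
  then show ?thesis
    using B by (intro exI[of _ B] exI[of _ "\<lambda>b. b \<bullet> (A *v b)"] conjI ballI) auto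
qed

section \<open>Existence and uniqueness of the positive semidefinite root\<close>

lemma pos_semidef_sqrt_exists:
  assumes "pos_semidef (A::real^'d^'d)"
  shows "\<exists>R. pos_semidef R \<and> R ** R = A"
proof -
  have sym: "symmetric_matrix A" and nn: "\<And>x. 0 \<le> x \<bullet> (A *v x)"
    using assms by (auto simp: pos_semidef_def)
  obtain B c where B: "finite B" "pairwise orthogonal B" "\<And>b. b \<in> B \<Longrightarrow> norm b = 1"
     and c: "\<And>b. b \<in> B \<Longrightarrow> A *v b = c b *\<^sub>R b" and ex: "\<forall>x. x = (\<Sum>b\<in>B. (b \<bullet> x) *\<^sub>R b)"
    using symmetric_matrix_eigenbasis[OF sym] by blast
  have c0: "c b \<ge> 0" if "b \<in> B" for b
    using nn[of b] c[OF that] B(3)[OF that] by (simp add: norm_eq_1)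
  have lin: "linear (\<lambda>x. \<Sum>b\<in>B. (sqrt (c b) * (b \<bullet> x)) *\<^sub>R b)"
    by (intro linearI) (auto simp: inner_add_right algebra_simps sum.distrib scaleR_sum_right)
  \<comment> \<open>\<open>R\<close> scales each eigenvector by the root of its eigenvalue. Symmetry
    and nonnegativity are visible in the bilinear form \<open>Rxy\<close>, and
    \<open>R ** R = A\<close> is checked on the eigenbasis.\<close>
  define R where "R = matrix (\<lambda>x. \<Sum>b\<in>B. (sqrt (c b) * (b \<bullet> x)) *\<^sub>R b)"
  have R: "R *v x = (\<Sum>b\<in>B. (sqrt (c b) * (b \<bullet> x)) *\<^sub>R b)" for x
    using fun_cong[OF matrix_vector_mul(2)[OF lin], of x] by (simp add: R_def)
  have Rxy: "y \<bullet> (R *v x) = (\<Sum>b\<in>B. sqrt (c b) * (b \<bullet> x) * (b \<bullet> y))" for x y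
    by (simp add: R inner_sum_right inner_commute)
  have Rb: "R *v b = sqrt (c b) *\<^sub>R b" if "b \<in> B" for b
  proof -
    have "R *v b = (\<Sum>b'\<in>B. if b' = b then sqrt (c b) *\<^sub>R b else 0)"
      unfolding R using B that
      by (intro sum.cong refl) (auto simp: pairwise_def orthogonal_def norm_eq_1)
    then show ?thesis using B(1) that by simp
  qed
  have "y \<bullet> (transpose R *v x) = y \<bullet> (R *v x)" for x y
  proof -
    have "y \<bullet> (transpose R *v x) = x \<bullet> (R *v y)"
      by (metis dot_lmul_matrix inner_commute transpose_matrix_vector)
    also have "\<dots> = y \<bullet> (R *v x)" by (simp add: Rxy mult_ac)
    finally show ?thesis .
  qed
  then have "transpose R *v x = R *v x" for x by (metis vector_eq_ldot)
  then have "transpose R = R" by (metis matrix_eq)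
  moreover have "0 \<le> x \<bullet> (R *v x)" for x
    unfolding Rxy using c0 by (intro sum_nonneg) (auto simp: mult.assoc)
  moreover have "(R ** R) *v x = A *v x" for x
  proof -
    have "(R ** R) *v b = A *v b" if "b \<in> B" for b
      using c0[OF that] c[OF that] Rb[OF that]
      by (simp add: matrix_vector_mul_assoc[symmetric] matrix_vector_mult_scaleR)
    then have "(R ** R) *v (\<Sum>b\<in>B. (b \<bullet> x) *\<^sub>R b) = A *v (\<Sum>b\<in>B. (b \<bullet> x) *\<^sub>R b)"
      by (simp add: linear_sum[OF matrix_vector_mul_linear] matrix_vector_mult_scaleR)
    then show ?thesis using spec[OF ex, of x] by metis
  qed
  then have "R ** R = A" by (metis matrix_eq)
  ultimately show ?thesis by (auto simp: pos_semidef_def symmetric_matrix_def)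
qed

lemma symmetric_matrix_eq_0:
  assumes sym: "symmetric_matrix (D::real^'d^'d)"
    and ev: "\<And>v c. v \<noteq> 0 \<Longrightarrow> D *v v = c *\<^sub>R v \<Longrightarrow> c = 0"
  shows "D = 0"
proof -
  obtain B c where B: "\<And>b. b \<in> B \<Longrightarrow> norm b = 1" "\<And>b. b \<in> B \<Longrightarrow> D *v b = c b *\<^sub>R b"
    and ex: "\<forall>x. x = (\<Sum>b\<in>B. (b \<bullet> x) *\<^sub>R b)"
    using symmetric_matrix_eigenbasis[OF sym] by blast
  have 0: "D *v b = 0" if "b \<in> B" for b
  proof -
    have "b \<noteq> 0" using B(1)[OF that] by auto
    then have "c b = 0" using ev B(2)[OF that] by blast
    then show ?thesis using B(2)[OF that] by simp
  qed
  have "D *v (\<Sum>b\<in>B. (b \<bullet> x) *\<^sub>R b) = 0" for x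
    by (simp add: linear_sum[OF matrix_vector_mul_linear] matrix_vector_mult_scaleR 0)
  then have "D *v x = 0" for x using spec[OF ex, of x] by metis
  then show ?thesis by (simp add: matrix_eq)
qed

text \<open>Every eigenvalue \<open>c\<close> of \<open>D = R - S\<close> vanishes: for an
  eigenvector \<open>v\<close>, equality of the squares gives \<open>|R v|^2 = |S v|^2\<close>, that
  is, \<open>c (v . R v + v . S v) = 0\<close>. If the bracket is zero, both forms vanish at
  \<open>v\<close> and \<open>c |v|^2 = v . D v = 0\<close>.\<close>

lemma pos_semidef_sqrt_unique:
  assumes R: "pos_semidef (R::real^'d^'d)" and S: "pos_semidef S" and eq: "R ** R = S ** S"
  shows "R = S"
proof -
  define D where "D = R - S"
  have symR: "symmetric_matrix R" and symS: "symmetric_matrix S"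
    and nn: "\<And>x. 0 \<le> x \<bullet> (R *v x)" "\<And>x. 0 \<le> x \<bullet> (S *v x)"
    using R S by (auto simp: pos_semidef_def)
  have symD: "symmetric_matrix D" unfolding D_def by (intro symmetric_matrix_algebra symR symS)
  have "D = 0"
  proof (rule symmetric_matrix_eq_0[OF symD])
    fix v c assume v: "v \<noteq> 0" and ev: "D *v v = c *\<^sub>R v"
    have e: "R *v v - S *v v = c *\<^sub>R v" using ev by (simp add: D_def algebra_simps)
    have "(R *v v) \<bullet> (R *v v) = v \<bullet> ((R ** R) *v v)"
      by (metis symR symmetric_matrix_inner matrix_vector_mul_assoc)
    also have "\<dots> = (S *v v) \<bullet> (S *v v)"
      unfolding eq by (metis symS symmetric_matrix_inner matrix_vector_mul_assoc)
    finally have "(R *v v - S *v v) \<bullet> (R *v v + S *v v) = 0"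
      by (simp add: inner_diff_left inner_add_right inner_commute[of "S *v v" "R *v v"])
    then have "c = 0 \<or> v \<bullet> (R *v v) + v \<bullet> (S *v v) = 0"
      unfolding e by (simp add: inner_add_right flip: distrib_left)
    moreover have "c = 0" if "v \<bullet> (R *v v) + v \<bullet> (S *v v) = 0"
    proof -
      have "v \<bullet> (R *v v) = 0" "v \<bullet> (S *v v) = 0" using that nn[of v] by linarith+
      then have "v \<bullet> (c *\<^sub>R v) = 0" unfolding e[symmetric] by (simp add: inner_diff_right)
      with v show ?thesis by simp
    qed
    ultimately show "c = 0" by blast
  qed
  then show ?thesis by (simp add: D_def)
qed

lemma mat_sqrt_properties:
  assumes "pos_semidef A"
  shows "pos_semidef (mat_sqrt A)" "mat_sqrt A ** mat_sqrt A = A"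
proof -
  have "\<exists>!R. pos_semidef R \<and> R ** R = A"
    using pos_semidef_sqrt_exists[OF assms] pos_semidef_sqrt_unique by metis
  from theI'[OF this] show "pos_semidef (mat_sqrt A)" "mat_sqrt A ** mat_sqrt A = A"
    unfolding mat_sqrt_def by auto
qed

lemma mat_sqrt_eqI:
  assumes "pos_semidef R" "R ** R = A" shows "mat_sqrt A = R"
  unfolding mat_sqrt_def using assms pos_semidef_sqrt_unique by (intro the_equality) auto

lemma pos_def_imp_pos_semidef: "pos_def A \<Longrightarrow> pos_semidef A"
  unfolding pos_def_def pos_semidef_def by (metis inner_zero_left less_eq_real_def)

section \<open>Trace inequalities and eigenvalue bounds\<close>

lemma mat_mult_scaleR: "mat c ** X = c *\<^sub>R X" "X ** mat c = c *\<^sub>R (X::real^'n^'n)"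
  by (simp_all add: matrix_matrix_mult_def mat_def vec_eq_iff if_distribR if_distrib[of "\<lambda>a. a * _"]
      if_distrib[of "\<lambda>a. _ * a"] mult.commute cong: if_cong)

lemma pos_semidef_conj:
  fixes A X :: "real^'d^'d"
  assumes "pos_semidef A"
  shows "pos_semidef (transpose X ** A ** X)"
proof -
  have "x \<bullet> ((transpose X ** A ** X) *v x) = (X *v x) \<bullet> (A *v (X *v x))" for x
    by (metis dot_lmul_matrix matrix_vector_mul_assoc vector_transpose_matrix)
  then show ?thesis using assms
    by (simp add: pos_semidef_def symmetric_matrix_algebra)
qed

lemma pos_semidef_conj_symmetric:
  "pos_semidef A \<Longrightarrow> symmetric_matrix X \<Longrightarrow> pos_semidef (X ** A ** X)"
  using pos_semidef_conj[of A X] by (simp add: symmetric_matrix_def)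

text \<open>The trace is the squared Frobenius norm of the square root.\<close>

lemma trace_pos_semidef_nonneg: assumes "pos_semidef A" shows "0 \<le> trace A"
proof -
  let ?R = "mat_sqrt A"
  have "symmetric_matrix ?R" using mat_sqrt_properties[OF assms] by (simp add: pos_semidef_def)
  then have "(norm ?R)\<^sup>2 = trace A"
    unfolding norm_matrix_power2 using mat_sqrt_properties[OF assms] by (simp add: symmetric_matrix_def)
  then show ?thesis by (metis zero_le_power2)
qed

text \<open>By cyclicity the trace is that of \<open>G\<close> conjugated by the root of
  \<open>P\<close>.\<close>

lemma trace_pos_semidef_mult_nonneg:
  assumes P: "pos_semidef P" and G: "pos_semidef G" shows "0 \<le> trace (P ** G)"
proof -
  let ?R = "mat_sqrt P"
  have R: "symmetric_matrix ?R" "?R ** ?R = P"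
    using mat_sqrt_properties[OF P] by (auto simp add: pos_semidef_def)
  have "trace (P ** G) = trace (?R ** (?R ** G))"
    by (simp add: matrix_mul_assoc R(2))
  also have "\<dots> = trace ((?R ** G) ** ?R)" by (rule trace_mul_sym)
  finally show ?thesis
    using trace_pos_semidef_nonneg[OF pos_semidef_conj_symmetric[OF G R(1)]] by simp
qed

lemma trace_mult_ge:
  assumes "pos_semidef P" "pos_semidef (A - mat c)" shows "c * trace P \<le> trace (P ** A)"
  using trace_pos_semidef_mult_nonneg[OF assms]
  by (simp add: matrix_mult.diff_right trace_sub mat_mult_scaleR trace_scaleR)

lemma trace_mult_le:
  assumes "pos_semidef P" "pos_semidef (mat c - A)" shows "trace (P ** A) \<le> c * trace P"
  using trace_pos_semidef_mult_nonneg[OF assms]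
  by (simp add: matrix_mult.diff_right trace_sub mat_mult_scaleR trace_scaleR)

text \<open>From here on \<open>pos_semidef (A - mat c)\<close> expresses that the spectrum of
  \<open>A\<close> is bounded below by \<open>c\<close>.\<close>

lemma pos_semidef_diff_mat_iff:
  "pos_semidef (A - mat c) \<longleftrightarrow> symmetric_matrix A \<and> (\<forall>x. c * (x \<bullet> x) \<le> x \<bullet> (A *v x))"
proof -
  have "symmetric_matrix (A - mat c) \<longleftrightarrow> symmetric_matrix A"
    using symmetric_matrix_algebra(2)[of "A - mat c" "mat c"] symmetric_matrix_algebra(3)[of A "mat c"]
      symmetric_matrix_algebra(1)[of c] by auto
  then show ?thesis
    by (simp add: pos_semidef_def inner_diff_right matrix_vector_mult_diff_rdistrib mat_scaleR_vector)
qed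

lemma pos_semidef_diff_mono:
  assumes "pos_semidef (A - mat c)" "d \<le> c" shows "pos_semidef (A - mat d)"
  using assms unfolding pos_semidef_diff_mat_iff
  by (meson inner_ge_zero mult_right_mono order_trans)

text \<open>The maximum of the Rayleigh quotient is itself an eigenvalue.\<close>

lemma spd_set_upper:
  assumes "A \<in> spd_set L" shows "pos_semidef (mat L - A)"
proof -
  have sym: "symmetric_matrix A" using assms by (simp add: spd_set_def pos_def_def)
  have ne: "(UNIV::(real^'a) set) \<noteq> {0}" by (metis UNIV_I singletonD zero_neq_one)
  obtain v c where "norm v = 1" "A *v v = c *\<^sub>R v" and le: "\<And>x. x \<bullet> (A *v x) \<le> c * (x \<bullet> x)"
    using Rayleigh_maximum[OF sym subspace_UNIV ne] by (metis UNIV_I)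
  then have "is_eigenvalue A c" unfolding is_eigenvalue_def by (metis norm_zero zero_neq_one)
  then have "c \<le> L" using assms by (simp add: spd_set_def)
  then have "x \<bullet> (A *v x) \<le> L * (x \<bullet> x)" for x
    using le[of x] mult_right_mono[of c L "x \<bullet> x"] by simp
  then show ?thesis using sym
    by (simp add: pos_semidef_def symmetric_matrix_algebra inner_diff_right
        matrix_vector_mult_diff_rdistrib mat_scaleR_vector)
qed

text \<open>\<open>Rayleigh_maximum\<close> for the negated matrix \<open>mat 0 - A\<close> shows
  that the Rayleigh quotient of \<open>A\<close> attains its minimum, which is therefore
  positive.\<close>

lemma pos_def_lower:
  assumes "pos_def (A::real^'d^'d)" shows "\<exists>\<delta>>0. pos_semidef (A - mat \<delta>)"
proof -
  have sym: "symmetric_matrix A" using assms by (simp add: pos_def_def)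
  have sym': "symmetric_matrix (mat 0 - A)" by (intro symmetric_matrix_algebra sym)
  have ne: "(UNIV::(real^'d) set) \<noteq> {0}" by (metis UNIV_I singletonD zero_neq_one)
  obtain v c where v: "norm v = 1" "(mat 0 - A) *v v = c *\<^sub>R v"
      and le: "\<And>x. x \<bullet> ((mat 0 - A) *v x) \<le> c * (x \<bullet> x)"
    using Rayleigh_maximum[OF sym' subspace_UNIV ne] by (metis UNIV_I)
  have "0 < v \<bullet> (A *v v)" using assms v by (metis norm_zero pos_def_def zero_neq_one)
  also have "\<dots> = - (v \<bullet> ((mat 0 - A) *v v))"
    by (simp add: matrix_vector_mult_diff_rdistrib inner_diff_right mat_scaleR_vector del: mat_0 diff_0)
  also have "\<dots> = - c" using v by (simp add: norm_eq_1)
  finally have "- c > 0" .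
  moreover have "- c * (x \<bullet> x) \<le> x \<bullet> (A *v x)" for x
    using le[of x]
    by (simp add: matrix_vector_mult_diff_rdistrib inner_diff_right mat_scaleR_vector del: mat_0 diff_0)
  ultimately show ?thesis using sym unfolding pos_semidef_diff_mat_iff by blast
qed

text \<open>The eigenvalue bound is used twice: \<open>tr (A A) <= L tr A\<close> and
  \<open>tr A <= L d\<close>. The resulting \<open>L^2 d\<close> is enlarged to
  \<open>(L d)^2\<close>.\<close>

lemma norm_spd_set_le:
  assumes "(A::real^'d^'d) \<in> spd_set L" and "L > 0" shows "norm A \<le> L * real CARD('d)"
proof -
  have A: "pos_semidef A" and sym: "transpose A = A"
    using assms by (auto simp: spd_set_def pos_def_imp_pos_semidef pos_def_def symmetric_matrix_def)
  note U = spd_set_upper[OF assms(1)]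
  have "trace (mat L :: real^'d^'d) = L * real CARD('d)"
    by (simp add: trace_def mat_def mult.commute)
  then have t: "trace A \<le> L * real CARD('d)" using trace_pos_semidef_nonneg[OF U] by (simp add: trace_sub)
  have "(norm A)\<^sup>2 \<le> L * trace A"
    using trace_mult_le[OF A U] by (simp add: norm_matrix_power2 sym)
  also have "\<dots> \<le> L * (L * real CARD('d))" using t assms(2) by simp
  also have "\<dots> \<le> (L * real CARD('d))\<^sup>2"
    using assms(2) by (simp add: power2_eq_square)
  finally show ?thesis using assms(2) by (simp add: power2_le_iff_abs_le)
qed

section \<open>Inverses and positive definiteness\<close>

lemma pos_def_inverse:
  assumes "pos_def (A::real^'d^'d)"
  obtains W where "A ** W = mat 1" "W ** A = mat 1" "symmetric_matrix W"
proof -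
  have "x = 0" if "A *v x = 0" for x
    using assms that by (metis inner_zero_right less_irrefl pos_def_def)
  then obtain W where W: "W ** A = mat 1" using matrix_left_invertible_ker[of A] by blast
  then have W': "A ** W = mat 1" by (simp add: matrix_left_right_inverse)
  have "transpose W ** A = mat 1"
    using arg_cong[OF W', of transpose] assms by (simp add: matrix_transpose_mul pos_def_def symmetric_matrix_def)
  then have "transpose W = W" by (metis W' matrix_mul_assoc matrix_mul_lid matrix_mul_rid)
  then show ?thesis using that W W' by (simp add: symmetric_matrix_def)
qed

text \<open>With \<open>x = Q y\<close> and \<open>S\<close> the root of \<open>Q\<close>,
  \<open>|x|^2 = (S y) . Q (S y) <= L |S y|^2 = L (x . W x)\<close>.\<close>

lemma spd_set_inverse:
  assumes Q: "Q \<in> spd_set L" and L: "L > 0"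
  obtains W where "Q ** W = mat 1" "W ** Q = mat 1" "pos_semidef W" "pos_semidef (W - mat (1 / L))"
proof -
  have pd: "pos_def Q" and psd: "pos_semidef Q"
    using Q by (simp_all add: spd_set_def pos_def_imp_pos_semidef)
  obtain W where W: "Q ** W = mat 1" "W ** Q = mat 1" "symmetric_matrix W"
    using pos_def_inverse[OF pd] .
  let ?S = "mat_sqrt Q"
  have S: "symmetric_matrix ?S" "?S ** ?S = Q"
    using mat_sqrt_properties[OF psd] by (auto simp: pos_semidef_def)
  have "(x \<bullet> x) \<le> L * (x \<bullet> (W *v x))" for x
  proof -
    define y where "y = W *v x"
    have x: "Q *v y = x" by (simp add: y_def matrix_vector_mul_assoc W(1))
    have "x \<bullet> x = (?S *v y) \<bullet> (Q *v (?S *v y))"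
      using S unfolding x[symmetric]
      by (metis matrix_vector_mul_assoc symmetric_matrix_inner)
    also have "\<dots> \<le> L * ((?S *v y) \<bullet> (?S *v y))"
      using spd_set_upper[OF Q]
      by (simp add: pos_semidef_def inner_diff_right matrix_vector_mult_diff_rdistrib mat_scaleR_vector)
    also have "(?S *v y) \<bullet> (?S *v y) = y \<bullet> (Q *v y)"
      using S by (metis matrix_vector_mul_assoc symmetric_matrix_inner)
    finally show ?thesis unfolding x by (simp add: y_def inner_commute)
  qed
  then have lower: "pos_semidef (W - mat (1 / L))"
    unfolding pos_semidef_diff_mat_iff using L W(3) by (simp add: divide_le_eq mult.commute)
  then have "pos_semidef (W - mat 0)" using L by (intro pos_semidef_diff_mono[OF lower]) simp
  then show ?thesis using that W lower by simp
qed

lemma pos_def_kernel: "pos_def A \<Longrightarrow> A *v x = 0 \<Longrightarrow> x = 0"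
  by (metis inner_zero_right less_irrefl pos_def_def)

lemma pos_def_conj:
  assumes A: "pos_def A" and X: "pos_def X" shows "pos_def (X ** A ** X)"
proof -
  have sym: "symmetric_matrix X" "symmetric_matrix A" using A X by (auto simp: pos_def_def)
  have "0 < x \<bullet> ((X ** A ** X) *v x)" if "x \<noteq> 0" for x
  proof -
    have "X *v x \<noteq> 0" using pos_def_kernel[OF X] that by blast
    then have "0 < (X *v x) \<bullet> (A *v (X *v x))" using A by (simp add: pos_def_def)
    then show ?thesis using symmetric_matrix_inner[OF sym(1), of x "A *v (X *v x)"]
      by (simp add: matrix_vector_mul_assoc matrix_mul_assoc)
  qed
  then show ?thesis using sym by (simp add: pos_def_def symmetric_matrix_algebra)
qed

text \<open>By \<open>psd_kernel\<close>, a vector at which the form of the root vanishes lies in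
  the kernel of the root, hence in that of \<open>A\<close>.\<close>

lemma pos_def_mat_sqrt:
  assumes A: "pos_def A" shows "pos_def (mat_sqrt A)"
proof -
  let ?R = "mat_sqrt A"
  have R: "pos_semidef ?R" "?R ** ?R = A"
    using mat_sqrt_properties[OF pos_def_imp_pos_semidef[OF A]] .
  have "0 < x \<bullet> (?R *v x)" if "x \<noteq> 0" for x
  proof (rule ccontr)
    assume "\<not> 0 < x \<bullet> (?R *v x)"
    then have "x \<bullet> (?R *v x) = 0" using R(1) by (metis less_eq_real_def pos_semidef_def)
    then have "w \<bullet> (?R *v x) = 0" for w
      using psd_kernel[OF _ subspace_UNIV, of ?R x w] R(1) by (simp add: pos_semidef_def)
    then have "?R *v x = 0" by (metis inner_eq_zero_iff)
    then have "A *v x = 0" using R(2) by (metis matrix_vector_mul_assoc matrix_vector_mult_0_right)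
    then show False using pos_def_kernel[OF A] that by blast
  qed
  then show ?thesis using R(1) by (simp add: pos_def_def pos_semidef_def)
qed

section \<open>Quadratic growth of the loss\<close>

text \<open>One summand of \<open>objective\<close>: the closed form of the squared 2-Wasserstein
  distance between \<open>N(0, T M T)\<close> and \<open>N(0, N)\<close>.\<close>

definition loss :: "real^'d^'d \<Rightarrow> real^'d^'d \<Rightarrow> real^'d^'d \<Rightarrow> real" where
  "loss M N T = trace (T ** M ** T) + trace N - 2 * trace (mat_sqrt (mat_sqrt N ** T ** M ** T ** mat_sqrt N))"

text \<open>\<open>Z\<close> is the optimal transport map from \<open>N(0, A)\<close> to \<open>N(0, N)\<close>.\<close>

lemma optimal_map_exists:
  fixes A N :: "real^'d^'d"
  assumes A: "pos_def A" and N: "pos_def N"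
  obtains Z where "symmetric_matrix Z" "Z ** A ** Z = N"
    "trace (mat_sqrt (mat_sqrt N ** A ** mat_sqrt N)) = trace (Z ** A)"
proof -
  define R where "R = mat_sqrt N"
  have R: "pos_def R" "R ** R = N"
    using mat_sqrt_properties[OF pos_def_imp_pos_semidef[OF N]] pos_def_mat_sqrt[OF N] by (auto simp: R_def)
  define C where "C = mat_sqrt (R ** A ** R)"
  have RAR: "pos_def (R ** A ** R)" using pos_def_conj[OF A R(1)] .
  have C: "pos_def C" "C ** C = R ** A ** R"
    using mat_sqrt_properties[OF pos_def_imp_pos_semidef[OF RAR]] pos_def_mat_sqrt[OF RAR] by (auto simp: C_def)
  obtain V where V: "C ** V = mat 1" "V ** C = mat 1" "symmetric_matrix V"
    using pos_def_inverse[OF C(1)] .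
  have Vc: "V ** (C ** X) = X" for X :: "real^'d^'d" by (simp add: matrix_mul_assoc V)
  \<comment> \<open>The classical formula \<open>N^(1/2) (N^(1/2) A N^(1/2))^(-1/2) N^(1/2)\<close>
    for the optimal map.\<close>
  define Z where "Z = R ** V ** R"
  have "symmetric_matrix Z" unfolding Z_def using R(1) V(3) by (simp add: symmetric_matrix_algebra pos_def_def)
  moreover have "Z ** A ** Z = N"
  proof -
    have "Z ** A ** Z = R ** V ** (R ** A ** R) ** V ** R" by (simp add: Z_def matrix_mul_assoc)
    also have "\<dots> = R ** (V ** (C ** (C ** V))) ** R" by (simp add: C(2)[symmetric] matrix_mul_assoc)
    also have "\<dots> = N" by (simp add: Vc V R)
    finally show ?thesis .
  qed
  moreover have "trace C = trace (Z ** A)"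
  proof -
    have "trace (Z ** A) = trace (R ** (V ** R ** A))" by (simp add: Z_def matrix_mul_assoc)
    also have "\<dots> = trace ((V ** R ** A) ** R)" by (rule trace_mul_sym)
    also have "\<dots> = trace (V ** (C ** C))" unfolding C(2) by (simp add: matrix_mul_assoc)
    finally show ?thesis by (simp add: Vc)
  qed
  ultimately show ?thesis using that by (simp add: C_def R_def)
qed

text \<open>With \<open>R\<close> the root of \<open>N\<close> and \<open>W\<close> the inverse of
  \<open>Q\<close>, the root of \<open>R A R\<close> is \<open>R W R\<close>, because
  \<open>W N W = A\<close>. This expresses that \<open>Q\<close> is the optimal map from
  \<open>N(0, A)\<close> to \<open>N(0, N)\<close>.\<close>

lemma trace_sqrt_of_pushforward:
  fixes A Q :: "real^'d^'d"
  assumes A: "pos_def A" and Q: "pos_def Q" and N: "N = Q ** A ** Q"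
  shows "trace (mat_sqrt (mat_sqrt N ** A ** mat_sqrt N)) = trace (Q ** A)"
proof -
  define R where "R = mat_sqrt N"
  have pN: "pos_def N" unfolding N using pos_def_conj[OF A Q] .
  have R: "pos_def R" "R ** R = N"
    using mat_sqrt_properties[OF pos_def_imp_pos_semidef[OF pN]] pos_def_mat_sqrt[OF pN] by (auto simp: R_def)
  obtain W where W: "Q ** W = mat 1" "W ** Q = mat 1" "symmetric_matrix W"
    using pos_def_inverse[OF Q] .
  have Wc: "W ** (Q ** X) = X" "Q ** (W ** X) = X" for X :: "real^'d^'d" by (simp_all add: matrix_mul_assoc W)
  \<comment> \<open>Exhibits the inverse as a conjugate of the positive semidefinite
    \<open>Q\<close>.\<close>
  have "W = W ** Q ** W" by (simp add: W)
  then have "pos_semidef W"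
    by (metis pos_def_imp_pos_semidef[OF Q] W(3) pos_semidef_conj_symmetric)
  then have "pos_semidef (R ** W ** R)"
    using pos_semidef_conj_symmetric R(1) unfolding pos_def_def by blast
  moreover have "(R ** W ** R) ** (R ** W ** R) = R ** A ** R"
  proof -
    have "(R ** W ** R) ** (R ** W ** R) = R ** (W ** (R ** R) ** W) ** R" by (simp add: matrix_mul_assoc)
    also have "W ** (R ** R) ** W = A"
      unfolding R N by (simp add: matrix_mul_assoc[symmetric] Wc W)
    finally show ?thesis .
  qed
  ultimately have "mat_sqrt (R ** A ** R) = R ** W ** R" by (rule mat_sqrt_eqI)
  then have "trace (mat_sqrt (R ** A ** R)) = trace (R ** (W ** R))" by (simp add: matrix_mul_assoc)
  also have "\<dots> = trace (W ** R ** R)" by (rule trace_mul_sym)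
  also have "\<dots> = trace (A ** Q)"
    by (simp add: matrix_mul_assoc[symmetric] R N Wc)
  also have "\<dots> = trace (Q ** A)" by (rule trace_mul_sym)
  finally show ?thesis by (simp add: R_def)
qed

text \<open>The first term has mean zero because \<open>E Q = I\<close>; the second is twice the duality gap of the potential
  \<open>x \<mapsto> x \<bullet> Q x / 2\<close> in the Kantorovich problem from \<open>N(0, A)\<close> to \<open>N(0, Q A0 Q)\<close>.\<close>

lemma loss_difference:
  fixes M T T0 Q W :: "real^'d^'d"
  assumes M: "pos_def M" and T: "pos_def T" and T0: "pos_def T0" and Q: "pos_def Q"
    and W: "Q ** W = mat 1" "W ** Q = mat 1"
  defines "A \<equiv> T ** M ** T" and "A0 \<equiv> T0 ** M ** T0"
  obtains Z where "symmetric_matrix Z" "Z ** A ** Z = Q ** A0 ** Q"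
    "loss M (Q ** A0 ** Q) T - loss M (Q ** A0 ** Q) T0 =
       trace ((mat 1 - Q) ** (A - A0)) + trace (A ** (Q - Z) ** W ** (Q - Z))"
proof -
  define N where "N = Q ** A0 ** Q"
  have A: "pos_def A" unfolding A_def by (rule pos_def_conj[OF M T])
  have A0: "pos_def A0" unfolding A0_def by (rule pos_def_conj[OF M T0])
  have N: "pos_def N" unfolding N_def by (rule pos_def_conj[OF A0 Q])
  obtain Z where Z: "symmetric_matrix Z" "Z ** A ** Z = N"
      "trace (mat_sqrt (mat_sqrt N ** A ** mat_sqrt N)) = trace (Z ** A)"
    using optimal_map_exists[OF A N] .
  note t0 = trace_sqrt_of_pushforward[OF A0 Q N_def]
  have lT: "loss M N T = trace A + trace N - 2 * trace (Z ** A)"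
    using Z(3) unfolding loss_def A_def by (simp add: matrix_mul_assoc)
  have lT0: "loss M N T0 = trace A0 + trace N - 2 * trace (Q ** A0)"
    using t0 unfolding loss_def A0_def by (simp add: matrix_mul_assoc)
  have Wc: "W ** (Q ** X) = X" "Q ** (W ** X) = X" for X :: "real^'d^'d" by (simp_all add: matrix_mul_assoc W)
  \<comment> \<open>Since \<open>W\<close> inverts \<open>Q\<close>, the product is
    \<open>Q - 2 Z + Z W Z\<close>.\<close>
  have "(Q - Z) ** W ** (Q - Z) = (Q - Z) - (Z - Z ** W ** Z)"
    by (simp add: matrix_mult.diff_left matrix_mult.diff_right matrix_mul_assoc[symmetric] Wc W)
  then have "A ** (Q - Z) ** W ** (Q - Z) = A ** ((Q - Z) - (Z - Z ** W ** Z))"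
    by (metis matrix_mul_assoc)
  then have "trace (A ** (Q - Z) ** W ** (Q - Z)) = trace (A ** ((Q - Z) - (Z - Z ** W ** Z)))"
    by (rule arg_cong)
  also have "\<dots> = trace (A ** Q) - 2 * trace (A ** Z) + trace (A ** Z ** W ** Z)"
    unfolding matrix_mult.diff_right trace_sub by (simp add: matrix_mul_assoc)
  \<comment> \<open>The transport equation enters here: cyclicity brings the factors into the order
    \<open>Z A Z W = N W = Q A0\<close>.\<close>
  also have "trace (A ** Z ** W ** Z) = trace (Q ** A0)"
  proof -
    have "trace (A ** Z ** W ** Z) = trace (Z ** (A ** Z ** W))" by (rule trace_mul_sym)
    also have "\<dots> = trace (N ** W)" by (simp add: Z(2)[symmetric] matrix_mul_assoc)
    also have "\<dots> = trace (Q ** A0)" by (simp add: N_def matrix_mul_assoc[symmetric] W)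
    finally show ?thesis .
  qed
  finally have "trace (A ** (Q - Z) ** W ** (Q - Z)) = trace (Q ** A) - 2 * trace (Z ** A) + trace (Q ** A0)"
    by (simp add: trace_mul_sym[of A])
  then have "loss M N T - loss M N T0 =
       trace ((mat 1 - Q) ** (A - A0)) + trace (A ** (Q - Z) ** W ** (Q - Z))"
    unfolding lT lT0 by (simp add: matrix_mult.diff_left matrix_mult.diff_right trace_sub)
  with Z(1,2) that show ?thesis by (simp add: N_def)
qed

section \<open>Lower bounds in the Frobenius norm\<close>

lemma norm_matrix_conj_ge:
  fixes M X :: "real^'d^'d"
  assumes "pos_semidef (M - mat c)"
  shows "c * (norm X)\<^sup>2 \<le> trace (transpose X ** M ** X)"
proof -
  have "0 \<le> trace (transpose X ** (M - mat c) ** X)"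
    by (intro trace_pos_semidef_nonneg pos_semidef_conj assms)
  then show ?thesis
    by (simp add: matrix_mult.diff_right matrix_mult.diff_left trace_sub mat_mult_scaleR trace_scaleR
        matrix_mult.scaleR_left norm_matrix_power2)
qed

lemma norm_matrix_mult_ge:
  fixes M X :: "real^'d^'d"
  assumes "pos_semidef (M - mat c)"
  shows "c * norm X \<le> norm (M ** X)"
proof (cases "X = 0")
  case False
  have "c * (norm X)\<^sup>2 \<le> trace (transpose X ** (M ** X))"
    using norm_matrix_conj_ge[OF assms, of X] by (simp add: matrix_mul_assoc)
  also have "\<dots> = X \<bullet> (M ** X)" by (simp add: inner_matrix_eq_trace)
  also have "\<dots> \<le> norm X * norm (M ** X)" by (rule norm_cauchy_schwarz)
  finally show ?thesis using False by (simp add: power2_eq_square)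
qed simp

text \<open>Cyclicity turns the gap into the trace of \<open>transpose Y ** M ** Y ** W\<close> with
  \<open>Y = T ** E\<close>. The bound is in terms of \<open>T ** E\<close> rather than
  \<open>E\<close> because the smallest eigenvalue of \<open>T\<close> has no uniform positive lower
  bound over \<open>spd_set L\<close>.\<close>

lemma pushforward_gap:
  fixes M T W E :: "real^'d^'d"
  assumes M: "pos_semidef M" and T: "symmetric_matrix T" and W: "pos_semidef W" and E: "symmetric_matrix E"
  shows "0 \<le> trace ((T ** M ** T) ** E ** W ** E)"
    and "pos_semidef (M - mat \<delta>) \<Longrightarrow> pos_semidef (W - mat w) \<Longrightarrow> w \<ge> 0 \<Longrightarrow>
      w * \<delta> * (norm (T ** E))\<^sup>2 \<le> trace ((T ** M ** T) ** E ** W ** E)"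
proof -
  let ?Y = "T ** E"
  have Yt: "transpose ?Y = E ** T" using T E by (simp add: matrix_transpose_mul symmetric_matrix_def)
  have "trace ((T ** M ** T) ** E ** W ** E) = trace (E ** (T ** M ** T ** E ** W))"
    by (rule trace_mul_sym)
  also have "\<dots> = trace (transpose ?Y ** M ** ?Y ** W)"
    unfolding Yt by (simp add: matrix_mul_assoc)
  finally have eq: "trace ((T ** M ** T) ** E ** W ** E) = trace ((transpose ?Y ** M ** ?Y) ** W)" .
  have psd: "pos_semidef (transpose ?Y ** M ** ?Y)" by (rule pos_semidef_conj[OF M])
  show "0 \<le> trace ((T ** M ** T) ** E ** W ** E)"
    unfolding eq by (rule trace_pos_semidef_mult_nonneg[OF psd W])
  assume \<delta>: "pos_semidef (M - mat \<delta>)" and w: "pos_semidef (W - mat w)" "w \<ge> 0"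
  have "w * \<delta> * (norm ?Y)\<^sup>2 \<le> w * trace (transpose ?Y ** M ** ?Y)"
    using mult_left_mono[OF norm_matrix_conj_ge[OF \<delta>, of ?Y] w(2)] by (simp add: mult.assoc)
  also have "\<dots> \<le> trace ((transpose ?Y ** M ** ?Y) ** W)" by (rule trace_mult_ge[OF psd w(1)])
  finally show "w * \<delta> * (norm ?Y)\<^sup>2 \<le> trace ((T ** M ** T) ** E ** W ** E)" unfolding eq .
qed

text \<open>Test \<open>X = T M T - T0 M T0\<close> against \<open>M D M\<close>, where
  \<open>D = T - T0\<close>. As \<open>X = T M D + D M T0\<close>, the pairing is
  \<open>tr (P T) + tr (P T0)\<close> with \<open>P = M D M D M\<close> positive semidefinite. The
  first trace is nonnegative, so \<open>T\<close> may be nearly singular; the second is at least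
  \<open>\<delta> tr P\<close>.\<close>

lemma conj_difference_lower:
  fixes M T T0 :: "real^'d^'d"
  assumes M: "pos_semidef (M - mat \<delta>)" "pos_semidef M" and T0: "pos_semidef (T0 - mat \<delta>)"
    and T: "pos_semidef T" and \<delta>: "\<delta> > 0" and nM: "norm M \<le> b"
  shows "\<delta>^4 * norm (T - T0) \<le> b\<^sup>2 * norm (T ** M ** T - T0 ** M ** T0)"
proof (cases "T = T0")
  case False
  define D where "D = T - T0"
  define X where "X = T ** M ** T - T0 ** M ** T0"
  define P where "P = M ** D ** M ** D ** M"
  have symM: "symmetric_matrix M" using M by (simp add: pos_semidef_def)
  have symT0: "symmetric_matrix T0" using T0 by (simp add: pos_semidef_diff_mat_iff)
  have symD: "symmetric_matrix D" using T symT0 by (simp add: D_def pos_semidef_def symmetric_matrix_algebra)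
  have tr: "transpose M = M" "transpose D = D" using symM symD by (auto simp: symmetric_matrix_def)
  have P: "P = transpose (D ** M) ** M ** (D ** M)"
    by (simp add: P_def matrix_transpose_mul tr matrix_mul_assoc)
  have psd: "pos_semidef P" unfolding P by (rule pos_semidef_conj[OF M(2)])
  have X: "X = T ** M ** D + D ** M ** T0"
    by (simp add: X_def D_def matrix_mult.diff_left matrix_mult.diff_right)
  have nDM: "\<delta> * norm D \<le> norm (D ** M)"
    using norm_matrix_mult_ge[OF M(1), of D] norm_transpose_matrix[of "M ** D"]
    by (simp add: matrix_transpose_mul tr)
  \<comment> \<open>Of the four factors \<open>\<delta>\<close>, one comes from \<open>T0\<close>,
    one from the middle \<open>M\<close> in \<open>P\<close>, and two from its outer factors
    \<open>M\<close> through \<open>norm (D ** M)\<close>.\<close>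
  have "\<delta>^4 * (norm D)\<^sup>2 = \<delta> * (\<delta> * (\<delta> * norm D)\<^sup>2)" by (simp add: power_mult_distrib power2_eq_square power4_eq_xxxx)
  also have "\<dots> \<le> \<delta> * (\<delta> * (norm (D ** M))\<^sup>2)"
    using nDM \<delta> by (intro mult_left_mono power_mono) auto
  also have "\<dots> \<le> \<delta> * trace P"
    unfolding P using \<delta> by (intro mult_left_mono norm_matrix_conj_ge M) auto
  also have "\<dots> \<le> trace (P ** T) + trace (P ** T0)"
    using trace_mult_ge[OF psd T0] trace_pos_semidef_mult_nonneg[OF psd T] by simp
  also have "trace (P ** T) = trace (M ** D ** (M ** D ** M ** T))" by (simp add: P_def matrix_mul_assoc)
  also have "\<dots> = trace (M ** D ** M ** T ** (M ** D))" by (rule trace_mul_sym)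
  also have "\<dots> + trace (P ** T0) = trace ((M ** D ** M) ** X)"
    by (simp add: X P_def matrix_add_ldistrib trace_add matrix_mul_assoc)
  also have "\<dots> = (M ** D ** M) \<bullet> X"
    by (simp add: inner_matrix_eq_trace matrix_transpose_mul tr matrix_mul_assoc)
  also have "\<dots> \<le> norm (M ** D ** M) * norm X" by (rule norm_cauchy_schwarz)
  also have "norm (M ** D ** M) \<le> b\<^sup>2 * norm D"
  proof -
    have "norm (M ** D ** M) \<le> norm (M ** D) * norm M" by (rule norm_matrix_mult_le)
    also have "\<dots> \<le> (norm M * norm D) * norm M" by (intro mult_right_mono norm_matrix_mult_le) auto
    also have "\<dots> = (norm M)\<^sup>2 * norm D" by (simp add: power2_eq_square)
    also have "\<dots> \<le> b\<^sup>2 * norm D" using nM by (intro mult_right_mono power_mono) auto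
    finally show ?thesis .
  qed
  finally have "\<delta>^4 * (norm D)\<^sup>2 \<le> b\<^sup>2 * norm D * norm X" by (simp add: mult_right_mono)
  then show ?thesis using False by (simp add: D_def X_def power2_eq_square)
qed simp

lemma conj_norm_lower:
  fixes Q X :: "real^'d^'d"
  assumes Q: "pos_semidef (Q - mat \<delta>)" and \<delta>: "\<delta> \<ge> 0"
  shows "\<delta>\<^sup>2 * norm X \<le> norm (Q ** X ** Q)"
proof -
  have tQ: "transpose Q = Q" using Q by (simp add: pos_semidef_diff_mat_iff symmetric_matrix_def)
  have "\<delta>\<^sup>2 * norm X \<le> \<delta> * norm (Q ** X)"
    using mult_left_mono[OF norm_matrix_mult_ge[OF Q, of X] \<delta>] by (simp add: power2_eq_square)
  also have "norm (Q ** X) = norm (transpose X ** Q)"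
    using norm_transpose_matrix[of "Q ** X"] by (simp add: matrix_transpose_mul tQ)
  also have "\<dots> = norm (transpose (Q ** X))" by (simp add: matrix_transpose_mul tQ)
  also have "\<delta> * \<dots> \<le> norm (Q ** transpose (Q ** X))" by (rule norm_matrix_mult_ge[OF Q])
  also have "\<dots> = norm (Q ** X ** Q)"
    using norm_transpose_matrix[of "Q ** X ** Q"] by (simp add: matrix_transpose_mul tQ matrix_mul_assoc)
  finally show ?thesis .
qed

text \<open>For samples without control on the smallest eigenvalues, only the sign of the gap is
  kept.\<close>

lemma loss_lower_bound:
  fixes T0 :: "real^'d^'d"
  assumes L: "L > 0" and T0: "T0 \<in> spd_set L" and M: "M \<in> spd_set L" and Q: "Q \<in> spd_set L"
    and T: "T \<in> spd_set L"
  shows "trace ((mat 1 - Q) ** (T ** M ** T - T0 ** M ** T0))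
    \<le> loss M (Q ** T0 ** M ** T0 ** Q) T - loss M (Q ** T0 ** M ** T0 ** Q) T0"
proof -
  have pd: "pos_def M" "pos_def T" "pos_def T0" "pos_def Q" using assms by (auto simp: spd_set_def)
  obtain W where W: "Q ** W = mat 1" "W ** Q = mat 1" and psdW: "pos_semidef W"
    using spd_set_inverse[OF Q L] .
  obtain Z where Z: "symmetric_matrix Z" "Z ** (T ** M ** T) ** Z = Q ** (T0 ** M ** T0) ** Q"
    "loss M (Q ** (T0 ** M ** T0) ** Q) T - loss M (Q ** (T0 ** M ** T0) ** Q) T0 =
       trace ((mat 1 - Q) ** (T ** M ** T - T0 ** M ** T0)) + trace ((T ** M ** T) ** (Q - Z) ** W ** (Q - Z))"
    using loss_difference[OF pd W] .
  have symE: "symmetric_matrix (Q - Z)" using pd Z by (simp add: symmetric_matrix_algebra pos_def_def)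
  have "0 \<le> trace ((T ** M ** T) ** (Q - Z) ** W ** (Q - Z))"
    using pd symE by (intro pushforward_gap psdW pos_def_imp_pos_semidef) (auto simp: pos_def_def)
  then show ?thesis using Z(3) by (simp add: matrix_mul_assoc)
qed

text \<open>With \<open>Y = T (Q - Z)\<close> the gap is at least \<open>\<delta> / L\<close> times
  \<open>|Y|^2\<close>. Conversely \<open>Y\<close> controls \<open>T - T0\<close>: the matrix
  \<open>Q (A - A0) Q = Q A Q - Z A Z\<close> is a sum of terms linear in \<open>Y\<close> with
  bounded coefficients, and \<open>conj_norm_lower\<close> and \<open>conj_difference_lower\<close>
  undo the two conjugations.\<close>

lemma loss_quadratic_lower_bound:
  fixes T0 :: "real^'d^'d"
  assumes L: "L > 0" and T0: "T0 \<in> spd_set L" and \<delta>: "\<delta> > 0" and T0\<delta>: "pos_semidef (T0 - mat \<delta>)"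
  obtains \<kappa> where "\<kappa> > 0" "\<And>M Q T. M \<in> spd_set L \<Longrightarrow> Q \<in> spd_set L \<Longrightarrow> T \<in> spd_set L \<Longrightarrow>
    pos_semidef (M - mat \<delta>) \<Longrightarrow> pos_semidef (Q - mat \<delta>) \<Longrightarrow>
    trace ((mat 1 - Q) ** (T ** M ** T - T0 ** M ** T0)) + \<kappa> * (norm (T - T0))\<^sup>2
      \<le> loss M (Q ** T0 ** M ** T0 ** Q) T - loss M (Q ** T0 ** M ** T0 ** Q) T0"
proof -
  define b where "b = L * real CARD('d)"
  have b: "b > 0" using L by (simp add: b_def)
  \<comment> \<open>\<open>z\<close> will bound \<open>norm (T ** Z)\<close>, and \<open>c\<close>
    the ratio of \<open>norm (T - T0)\<close> to \<open>norm Y\<close>. In \<open>\<kappa>\<close>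
    the factor \<open>1 / L\<close> is the lower bound for the inverse of \<open>Q\<close>.\<close>
  define z where "z = sqrt (b^5 / \<delta>)"
  define c where "c = b\<^sup>2 / \<delta>^4 * (1 / \<delta>\<^sup>2) * (b^3 + z * b)"
  have "z \<ge> 0" using b \<delta> by (simp add: z_def)
  then have "b^3 + z * b > 0" using b by (simp add: add_pos_nonneg)
  then have c: "c > 0" unfolding c_def using b \<delta> by simp
  define \<kappa> where "\<kappa> = 1 / L * \<delta> / c\<^sup>2"
  have "\<kappa> > 0" using L \<delta> c by (simp add: \<kappa>_def)
  moreover have "trace ((mat 1 - Q) ** (T ** M ** T - T0 ** M ** T0)) + \<kappa> * (norm (T - T0))\<^sup>2
      \<le> loss M (Q ** T0 ** M ** T0 ** Q) T - loss M (Q ** T0 ** M ** T0 ** Q) T0"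
    if M: "M \<in> spd_set L" "pos_semidef (M - mat \<delta>)" and Q: "Q \<in> spd_set L" "pos_semidef (Q - mat \<delta>)"
      and T: "T \<in> spd_set L" for M Q T :: "real^'d^'d"
  proof -
    have n: "norm M \<le> b" "norm Q \<le> b" "norm T \<le> b" "norm T0 \<le> b"
      using norm_spd_set_le L M Q T T0 by (auto simp: b_def)
    have pd: "pos_def M" "pos_def T" "pos_def T0" "pos_def Q" using M Q T T0 by (auto simp: spd_set_def)
    then have tr: "transpose M = M" "transpose T = T" "transpose T0 = T0" "transpose Q = Q"
      by (auto simp: pos_def_def symmetric_matrix_def)
    obtain W where W: "Q ** W = mat 1" "W ** Q = mat 1" and psdW: "pos_semidef W"
      and WL: "pos_semidef (W - mat (1 / L))"
      using spd_set_inverse[OF Q(1) L] .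
    define A where "A = T ** M ** T"
    define A0 where "A0 = T0 ** M ** T0"
    obtain Z where Z: "symmetric_matrix Z" "Z ** A ** Z = Q ** A0 ** Q"
      "loss M (Q ** A0 ** Q) T - loss M (Q ** A0 ** Q) T0 =
         trace ((mat 1 - Q) ** (A - A0)) + trace (A ** (Q - Z) ** W ** (Q - Z))"
      using loss_difference[OF pd W] unfolding A_def A0_def .
    define E where "E = Q - Z"
    have symE: "symmetric_matrix E" using pd Z by (simp add: symmetric_matrix_algebra pos_def_def E_def)
    define Y where "Y = T ** E"
    have Yt: "transpose Y = E ** T" using symE by (simp add: Y_def matrix_transpose_mul tr symmetric_matrix_def)
    have Zt: "transpose Z = Z" using Z by (simp add: symmetric_matrix_def)
    have gap: "1 / L * \<delta> * (norm Y)\<^sup>2 \<le> trace (A ** E ** W ** E)"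
      unfolding A_def Y_def using pd symE L
      by (intro pushforward_gap psdW pos_def_imp_pos_semidef WL M) (auto simp: pos_def_def)
    \<comment> \<open>\<open>T\<close> may be nearly singular and \<open>Z\<close> large, but
      \<open>T Z\<close> stays bounded: \<open>tr (Z A Z) = tr (Q A0 Q)\<close> is at most
      \<open>b^5\<close>, and \<open>M\<close> is bounded below by \<open>\<delta>\<close>.\<close>
    have "\<delta> * (norm (T ** Z))\<^sup>2 \<le> trace (transpose (T ** Z) ** M ** (T ** Z))"
      by (rule norm_matrix_conj_ge[OF M(2)])
    also have "\<dots> = trace (Z ** A ** Z)" by (simp add: A_def matrix_transpose_mul tr Zt matrix_mul_assoc)
    also have "\<dots> = trace (transpose (T0 ** Q) ** (M ** T0 ** Q))"
      unfolding Z by (simp add: A0_def matrix_transpose_mul tr matrix_mul_assoc)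
    also have "\<dots> = (T0 ** Q) \<bullet> (M ** T0 ** Q)" by (simp add: inner_matrix_eq_trace)
    also have "\<dots> \<le> norm (T0 ** Q) * norm (M ** T0 ** Q)" by (rule norm_cauchy_schwarz)
    also have "\<dots> \<le> (norm T0 * norm Q) * ((norm M * norm T0) * norm Q)"
      by (intro mult_mono norm_matrix_mult_le order_trans[OF norm_matrix_mult_le]) auto
    also have "\<dots> \<le> (b * b) * ((b * b) * b)" using n b by (intro mult_mono) auto
    finally have "(norm (T ** Z))\<^sup>2 \<le> b^5 / \<delta>"
      using \<delta> by (simp add: field_simps power_numeral_reduce)
    then have nTZ: "norm (T ** Z) \<le> z" unfolding z_def by (rule real_le_rsqrt)
    then have nZT: "norm (Z ** T) \<le> z"
      using norm_transpose_matrix[of "T ** Z"] by (simp add: matrix_transpose_mul tr Zt)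
    \<comment> \<open>Telescoping puts one \<open>E\<close> next to a factor \<open>T\<close> of
      \<open>A\<close> in each term, which produces \<open>Y\<close> or its transpose.\<close>
    have "Q ** (A - A0) ** Q = E ** A ** Q + Z ** A ** E"
    proof -
      have "Q ** (A - A0) ** Q = Q ** A ** Q - Z ** A ** Z"
        unfolding Z by (simp add: matrix_mult.diff_left matrix_mult.diff_right)
      then show ?thesis by (simp add: E_def matrix_mult.diff_left matrix_mult.diff_right)
    qed
    also have "E ** A ** Q = transpose Y ** M ** T ** Q" unfolding Yt by (simp add: A_def matrix_mul_assoc)
    also have "Z ** A ** E = (Z ** T) ** M ** Y" unfolding Y_def by (simp add: A_def matrix_mul_assoc)
    finally have "norm (Q ** (A - A0) ** Q) \<le> norm (transpose Y ** M ** T ** Q) + norm ((Z ** T) ** M ** Y)"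
      by (simp add: norm_triangle_ineq)
    also have "\<dots> \<le> norm Y * b * b * b + z * b * norm Y"
    proof (intro add_mono)
      have "norm (transpose Y ** M ** T ** Q) \<le> norm (transpose Y) * norm M * norm T * norm Q"
        by (intro order_trans[OF norm_matrix_mult_le] mult_right_mono) auto
      also have "\<dots> \<le> norm Y * b * b * b"
        unfolding norm_transpose_matrix using n b by (intro mult_mono) auto
      finally show "norm (transpose Y ** M ** T ** Q) \<le> norm Y * b * b * b" .
      have "norm ((Z ** T) ** M ** Y) \<le> norm ((Z ** T) ** M) * norm Y" by (rule norm_matrix_mult_le)
      also have "\<dots> \<le> norm (Z ** T) * norm M * norm Y"
        by (intro mult_right_mono norm_matrix_mult_le) auto
      also have "\<dots> \<le> z * b * norm Y" using n b nZT \<open>z \<ge> 0\<close> by (intro mult_mono) auto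
      finally show "norm ((Z ** T) ** M ** Y) \<le> z * b * norm Y" .
    qed
    also have "\<dots> = (b^3 + z * b) * norm Y" by (simp add: algebra_simps power3_eq_cube)
    finally have nQ: "norm (Q ** (A - A0) ** Q) \<le> (b^3 + z * b) * norm Y" .
    have "\<delta>^4 * norm (T - T0) \<le> b\<^sup>2 * norm (A - A0)"
      unfolding A_def A0_def using n \<delta> pd M(2) T0\<delta>
      by (intro conj_difference_lower) (auto intro: pos_def_imp_pos_semidef)
    then have "norm (T - T0) \<le> b\<^sup>2 / \<delta>^4 * norm (A - A0)" using \<delta> by (simp add: field_simps)
    also have "\<dots> \<le> b\<^sup>2 / \<delta>^4 * (1 / \<delta>\<^sup>2 * norm (Q ** (A - A0) ** Q))"
      using conj_norm_lower[OF Q(2), of "A - A0"] \<delta> b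
      by (intro mult_left_mono) (auto simp: field_simps)
    also have "\<dots> \<le> b\<^sup>2 / \<delta>^4 * (1 / \<delta>\<^sup>2 * ((b^3 + z * b) * norm Y))"
      using nQ \<delta> b by (intro mult_left_mono) auto
    also have "\<dots> = c * norm Y" by (simp add: c_def)
    finally have "(norm (T - T0))\<^sup>2 \<le> c\<^sup>2 * (norm Y)\<^sup>2"
      by (metis norm_ge_zero power_mono power_mult_distrib)
    then have "\<kappa> * (norm (T - T0))\<^sup>2 \<le> 1 / L * \<delta> * (norm Y)\<^sup>2"
      using mult_left_mono[of "(norm (T - T0))\<^sup>2" "c\<^sup>2 * (norm Y)\<^sup>2" \<kappa>] \<open>\<kappa> > 0\<close> c
      by (simp add: \<kappa>_def)
    also note gap
    finally show ?thesis using Z(3) by (simp add: A_def A0_def E_def matrix_mul_assoc)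
  qed
  ultimately show ?thesis using that by blast
qed

section \<open>The linear noise term and the deterministic error bound\<close>

lemma trace_mult4:
  "trace (G ** X ** M ** (Y::real^'d^'d)) =
    (\<Sum>a\<in>UNIV. \<Sum>b\<in>UNIV. \<Sum>c\<in>UNIV. \<Sum>e\<in>UNIV. (G$a$b * M$c$e) * (X$b$c * Y$e$a))"
  for G X M :: "real^'d^'d"
proof -
  have "trace (G ** X ** M ** Y) = (\<Sum>a\<in>UNIV. (\<Sum>e\<in>UNIV. \<Sum>c\<in>UNIV. \<Sum>b\<in>UNIV. (G$a$b * M$c$e) * (X$b$c * Y$e$a)))"
    unfolding trace_def matrix_matrix_mult_def
    by (simp only: vec_lambda_beta sum_distrib_right) (simp only: mult.assoc mult.left_commute mult.commute)
  also have "\<dots> = (\<Sum>a\<in>UNIV. (\<Sum>b\<in>UNIV. \<Sum>c\<in>UNIV. \<Sum>e\<in>UNIV. (G$a$b * M$c$e) * (X$b$c * Y$e$a)))"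
  proof (rule sum.cong[OF refl])
    fix a
    let ?f = "\<lambda>b c e. (G$a$b * M$c$e) * (X$b$c * Y$e$a)"
    have "(\<Sum>e\<in>UNIV. \<Sum>c\<in>UNIV. \<Sum>b\<in>UNIV. ?f b c e) = (\<Sum>e\<in>UNIV. \<Sum>b\<in>UNIV. \<Sum>c\<in>UNIV. ?f b c e)"
      by (rule sum.cong[OF refl], rule sum.swap)
    also have "\<dots> = (\<Sum>b\<in>UNIV. \<Sum>e\<in>UNIV. \<Sum>c\<in>UNIV. ?f b c e)" by (rule sum.swap)
    also have "\<dots> = (\<Sum>b\<in>UNIV. \<Sum>c\<in>UNIV. \<Sum>e\<in>UNIV. ?f b c e)"
      by (rule sum.cong[OF refl], rule sum.swap)
    finally show "(\<Sum>e\<in>UNIV. \<Sum>c\<in>UNIV. \<Sum>b\<in>UNIV. ?f b c e) = (\<Sum>b\<in>UNIV. \<Sum>c\<in>UNIV. \<Sum>e\<in>UNIV. ?f b c e)" .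
  qed
  finally show ?thesis .
qed

lemma abs_matrix_component_le: "\<bar>(A::real^'n^'m)$i$j\<bar> \<le> norm A"
  by (rule order_trans[OF component_le_norm_cart Finite_Cartesian_Product.norm_nth_le])

text \<open>\<open>trace_mult4\<close> separates the sample from \<open>X\<close> and
  \<open>Y\<close>, so finitely many sums over the sample control all \<open>X\<close> and
  \<open>Y\<close> at once. This makes the noise bound uniform in \<open>T\<close>; the factor
  \<open>CARD('d)^4\<close> counts the index quadruples.\<close>

lemma sum_trace_mult4_le:
  fixes G M :: "'i \<Rightarrow> real^'d^'d"
  assumes v: "\<And>a b c e. \<bar>\<Sum>i\<in>I. G i$a$b * M i$c$e\<bar> \<le> v"
  shows "\<bar>\<Sum>i\<in>I. trace (G i ** X ** M i ** Y)\<bar> \<le> real CARD('d)^4 * (v * (norm X * norm Y))"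
proof -
  have v0: "v \<ge> 0" using v[of undefined undefined undefined undefined] by linarith
  \<comment> \<open>The outer index set is fixed to \<open>I\<close>, so that rewriting moves the
    sample sum inward past each coordinate sum and then stops.\<close>
  have swap: "(\<Sum>i\<in>I. \<Sum>a\<in>UNIV. f i a) = (\<Sum>a\<in>UNIV. \<Sum>i\<in>I. f i a)" for f :: "'i \<Rightarrow> 'd \<Rightarrow> real"
    by (rule sum.swap)
  have "(\<Sum>i\<in>I. trace (G i ** X ** M i ** Y)) =
    (\<Sum>a\<in>UNIV. \<Sum>b\<in>UNIV. \<Sum>c\<in>UNIV. \<Sum>e\<in>UNIV. (\<Sum>i\<in>I. G i$a$b * M i$c$e) * (X$b$c * Y$e$a))"
    unfolding trace_mult4 sum_distrib_right swap ..
  also have "\<bar>\<dots>\<bar> \<le> (\<Sum>a\<in>(UNIV::'d set). \<Sum>b\<in>(UNIV::'d set). \<Sum>c\<in>(UNIV::'d set). \<Sum>e\<in>(UNIV::'d set). v * (norm X * norm Y))"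
  proof (intro order_trans[OF sum_abs] sum_mono)
    fix a b c e
    show "\<bar>(\<Sum>i\<in>I. G i$a$b * M i$c$e) * (X$b$c * Y$e$a)\<bar> \<le> v * (norm X * norm Y)"
      unfolding abs_mult using v[of a b c e] v0 by (intro mult_mono abs_matrix_component_le) auto
  qed
  finally show ?thesis by (simp add: power4_eq_xxxx mult.assoc)
qed

text \<open>A deterministic statement: chance enters only through \<open>v\<close>, the size of the
  fluctuations, and \<open>half\<close>, the share of well-conditioned samples. Optimality makes the
  summed loss differences nonpositive, so the curvature \<open>n \<kappa> |D|^2 / 2\<close> is
  dominated by noise of order \<open>k sqrt n |D|\<close>, and one factor \<open>sqrt n |D|\<close>
  cancels.\<close>

lemma minimizer_error_bound:
  fixes M Q :: "nat \<Rightarrow> real^'d^'d"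
  assumes L: "L > 0" and T0: "T0 \<in> spd_set L" and T: "T \<in> spd_set L"
    and M: "\<And>i. i < n \<Longrightarrow> M i \<in> spd_set L" and Q: "\<And>i. i < n \<Longrightarrow> Q i \<in> spd_set L"
    and \<kappa>: "\<kappa> > 0" "\<And>i. i < n \<Longrightarrow> pos_semidef (M i - mat \<delta>) \<Longrightarrow> pos_semidef (Q i - mat \<delta>) \<Longrightarrow>
      trace ((mat 1 - Q i) ** (T ** M i ** T - T0 ** M i ** T0)) + \<kappa> * (norm (T - T0))\<^sup>2
      \<le> loss (M i) (Q i ** T0 ** M i ** T0 ** Q i) T - loss (M i) (Q i ** T0 ** M i ** T0 ** Q i) T0"
    and min: "objective M (\<lambda>i. Q i ** T0 ** M i ** T0 ** Q i) n T \<le> objective M (\<lambda>i. Q i ** T0 ** M i ** T0 ** Q i) n T0"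
    and v: "\<And>a b c e. \<bar>\<Sum>i<n. (mat 1 - Q i)$a$b * M i$c$e\<bar> \<le> k * sqrt (real n)"
    and half: "real n / 2 \<le> real (card {i. i < n \<and> pos_semidef (M i - mat \<delta>) \<and> pos_semidef (Q i - mat \<delta>)})"
    and n: "n \<ge> 1"
  shows "sqrt (real n) * norm (T - T0) \<le> 4 * real CARD('d)^4 * k * (L * real CARD('d)) / \<kappa>"
proof -
  let ?N = "\<lambda>i. Q i ** T0 ** M i ** T0 ** Q i"
  define D where "D = T - T0"
  define d where "d = real CARD('d)"
  define I where "I = {i. i < n \<and> pos_semidef (M i - mat \<delta>) \<and> pos_semidef (Q i - mat \<delta>)}"
  define V where "V = (\<Sum>i<n. trace ((mat 1 - Q i) ** (T ** M i ** T - T0 ** M i ** T0)))"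
  have k0: "k * sqrt (real n) \<ge> 0" using v[of undefined undefined undefined undefined] by linarith
  have obj: "objective M ?N n S = (\<Sum>i<n. loss (M i) (?N i) S)" for S
    unfolding objective_def loss_def ..
  have "V + (\<Sum>i<n. if i \<in> I then \<kappa> * (norm D)\<^sup>2 else 0)
      = (\<Sum>i<n. trace ((mat 1 - Q i) ** (T ** M i ** T - T0 ** M i ** T0)) + (if i \<in> I then \<kappa> * (norm D)\<^sup>2 else 0))"
    by (simp add: V_def sum.distrib)
  also have "\<dots> \<le> (\<Sum>i<n. loss (M i) (?N i) T - loss (M i) (?N i) T0)"
  proof (rule sum_mono)
    fix i assume "i \<in> {..<n}"
    then show "trace ((mat 1 - Q i) ** (T ** M i ** T - T0 ** M i ** T0)) + (if i \<in> I then \<kappa> * (norm D)\<^sup>2 else 0)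
      \<le> loss (M i) (?N i) T - loss (M i) (?N i) T0"
      using \<kappa>(2)[of i] loss_lower_bound[OF L T0 M Q T, of i i] by (auto simp: I_def D_def)
  qed
  also have "\<dots> \<le> 0" using min unfolding obj by (simp add: sum_subtractf)
  finally have "(\<Sum>i<n. if i \<in> I then \<kappa> * (norm D)\<^sup>2 else 0) \<le> - V" by simp
  also have "(\<Sum>i<n. if i \<in> I then \<kappa> * (norm D)\<^sup>2 else 0) = real (card I) * (\<kappa> * (norm D)\<^sup>2)"
  proof -
    have "{..<n} \<inter> I = I" by (auto simp: I_def)
    then show ?thesis by (simp flip: sum.inter_restrict)
  qed
  finally have "real (card I) * (\<kappa> * (norm D)\<^sup>2) \<le> \<bar>V\<bar>" by simp
  moreover have "real n / 2 * (\<kappa> * (norm D)\<^sup>2) \<le> real (card I) * (\<kappa> * (norm D)\<^sup>2)"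
    using half \<kappa>(1) by (intro mult_right_mono) (auto simp: I_def)
  moreover have "\<bar>V\<bar> \<le> 2 * (d^4 * (k * sqrt (real n) * (norm D * (L * d))))"
  proof -
    have nT: "norm T \<le> L * d" "norm T0 \<le> L * d" using norm_spd_set_le[OF _ L] T T0 by (auto simp: d_def)
    \<comment> \<open>Telescoping \<open>T X T - T0 X T0\<close> isolates one factor
      \<open>D\<close> per term, which makes the noise bound linear in
      \<open>norm D\<close>.\<close>
    have "V = (\<Sum>i<n. trace ((mat 1 - Q i) ** D ** M i ** T)) + (\<Sum>i<n. trace ((mat 1 - Q i) ** T0 ** M i ** D))"
    proof -
      have "T ** X ** T - T0 ** X ** T0 = D ** X ** T + T0 ** X ** D" for X
        by (simp add: D_def matrix_mult.diff_left matrix_mult.diff_right)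
      then show ?thesis
        by (simp add: V_def matrix_add_ldistrib trace_add matrix_mul_assoc sum.distrib)
    qed
    moreover have "\<bar>\<Sum>i<n. trace ((mat 1 - Q i) ** D ** M i ** T)\<bar> \<le> d^4 * (k * sqrt (real n) * (norm D * norm T))"
      unfolding d_def by (rule sum_trace_mult4_le[OF v])
    moreover have "\<bar>\<Sum>i<n. trace ((mat 1 - Q i) ** T0 ** M i ** D)\<bar> \<le> d^4 * (k * sqrt (real n) * (norm T0 * norm D))"
      unfolding d_def by (rule sum_trace_mult4_le[OF v])
    moreover have "d^4 * (k * sqrt (real n) * (norm D * norm T)) \<le> d^4 * (k * sqrt (real n) * (norm D * (L * d)))"
      using nT k0 by (intro mult_left_mono) (auto simp: d_def)
    moreover have "d^4 * (k * sqrt (real n) * (norm T0 * norm D)) \<le> d^4 * (k * sqrt (real n) * (norm D * (L * d)))"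
      using nT k0 unfolding mult.commute[of "norm T0"] by (intro mult_left_mono) (auto simp: d_def)
    ultimately show ?thesis by linarith
  qed
  ultimately have main: "real n / 2 * (\<kappa> * (norm D)\<^sup>2) \<le> 2 * (d^4 * (k * sqrt (real n) * (norm D * (L * d))))"
    by linarith
  have "sqrt (real n) * norm D \<le> 4 * d^4 * k * (L * d) / \<kappa>"
  proof (cases "D = 0")
    case True
    have "k \<ge> 0" using k0 n by (simp add: zero_le_mult_iff)
    then show ?thesis using True L \<kappa>(1) by (simp add: d_def)
  next
    case False
    define s where "s = sqrt (real n)"
    have s: "s > 0" "real n = s * s" using n by (auto simp: s_def)
    have "(s * norm D) * (s * norm D * \<kappa>) \<le> (s * norm D) * (4 * d^4 * k * (L * d))"
      using main s(1) unfolding s_def[symmetric] s(2) by (simp add: power2_eq_square mult_ac)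
    then have "s * norm D * \<kappa> \<le> 4 * d^4 * k * (L * d)" using s False by (simp add: mult_le_cancel_left_pos)
    then show ?thesis using \<kappa>(1) by (simp add: s_def pos_le_divide_eq)
  qed
  then show ?thesis by (simp add: D_def d_def)
qed

section \<open>Comparison of \<open>\<rho>\<close> with the Frobenius norm\<close>

abbreviation std_gaussian :: "('d \<Rightarrow> real) measure" where
  "std_gaussian \<equiv> PiM UNIV (\<lambda>_. density lborel (\<lambda>t. ennreal (std_normal_density t)))"

lemma measurable_std_gaussian_vec: "(\<lambda>z. \<chi> i. z i) \<in> measurable (std_gaussian :: ('d::finite \<Rightarrow> real) measure) borel"
proof -
  have "(\<lambda>z. (\<chi> i. z i) \<bullet> (b::real^'d)) \<in> borel_measurable (std_gaussian :: ('d \<Rightarrow> real) measure)" for b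
    by (simp add: inner_vec_def)
  then show ?thesis by (subst borel_measurable_euclidean_space) auto
qed

text \<open>Each coordinate projection has the standard normal law, whose second moment is
  1.\<close>

lemma nn_integral_std_gaussian_norm2:
  "(\<integral>\<^sup>+ z. ennreal ((norm (\<chi> i. z i))\<^sup>2) \<partial>(std_gaussian :: ('d::finite \<Rightarrow> real) measure)) = ennreal (real CARD('d))"
proof -
  let ?G = "std_gaussian :: ('d \<Rightarrow> real) measure"
  have 1: "(\<integral>\<^sup>+ t. ennreal (t\<^sup>2) \<partial>std_normal_distribution) = 1"
    using std_normal_distribution_even_moments[of 1]
    by (subst nn_integral_eq_integral) auto
  have 2: "(\<integral>\<^sup>+ z. ennreal ((z i)\<^sup>2) \<partial>?G) = 1" for i
  proof -
    have "distr ?G std_normal_distribution (\<lambda>z. z i) = std_normal_distribution"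
      by (intro distr_PiM_component) (auto intro: prob_space_normal_density)
    then have "(\<integral>\<^sup>+ t. ennreal (t\<^sup>2) \<partial>distr ?G std_normal_distribution (\<lambda>z. z i)) = 1" using 1 by simp
    then show ?thesis by (subst (asm) nn_integral_distr) auto
  qed
  have "(\<integral>\<^sup>+ z. ennreal ((norm (\<chi> i. z i))\<^sup>2) \<partial>?G) = (\<integral>\<^sup>+ z. (\<Sum>i\<in>UNIV. ennreal ((z i)\<^sup>2)) \<partial>?G)"
    by (simp add: norm_vec_def L2_set_def sum_nonneg)
  also have "\<dots> = (\<Sum>i\<in>(UNIV::'d set). 1)"
    by (subst nn_integral_sum) (auto simp: 2)
  finally show ?thesis by (simp add: ennreal_of_nat_eq_real_of_nat)
qed

text \<open>The two maps applied to one common Gaussian vector form a coupling.\<close>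

lemma wasserstein2_linear_push_le:
  fixes A :: "real^'d^'d"
  assumes A: "pos_semidef A"
  shows "(wasserstein2 (linear_push T1 (centred_gaussian A)) (linear_push T2 (centred_gaussian A)))\<^sup>2
    \<le> (norm (T1 - T2))\<^sup>2 * trace A * real CARD('d)"
proof -
  let ?G = "std_gaussian :: ('d \<Rightarrow> real) measure"
  let ?R = "mat_sqrt A"
  have [measurable]: "(\<lambda>x. B *v x) \<in> borel_measurable borel" for B :: "real^'d^'d"
    by (intro borel_measurable_continuous_onI linear_continuous_on matrix_vector_mul_bounded_linear)
  define f where "f = (\<lambda>z::'d \<Rightarrow> real. ?R *v (\<chi> i. z i))"
  note [measurable] = measurable_std_gaussian_vec
  have f[measurable]: "f \<in> measurable ?G borel" unfolding f_def by measurable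
  interpret G: prob_space ?G by (intro prob_space_PiM prob_space_normal_density) simp
  define \<pi> where "\<pi> = distr ?G (borel \<Otimes>\<^sub>M borel) (\<lambda>z. (T1 *v f z, T2 *v f z))"
  have push: "linear_push T (centred_gaussian A) = distr ?G borel (\<lambda>z. T *v f z)" for T
    unfolding linear_push_def centred_gaussian_def f_def[symmetric] by (subst distr_distr) (auto simp: comp_def)
  have "\<pi> \<in> couplings (linear_push T1 (centred_gaussian A)) (linear_push T2 (centred_gaussian A))"
    unfolding couplings_def push \<pi>_def
    by (auto intro!: G.prob_space_distr simp: distr_distr comp_def)
  then have "(INF \<pi>\<in>couplings (linear_push T1 (centred_gaussian A)) (linear_push T2 (centred_gaussian A)).
      \<integral>\<^sup>+ z. ennreal ((dist (fst z) (snd z))\<^sup>2) \<partial>\<pi>) \<le> (\<integral>\<^sup>+ z. ennreal ((dist (fst z) (snd z))\<^sup>2) \<partial>\<pi>)"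
    by (rule INF_lower)
  also have "\<dots> = (\<integral>\<^sup>+ z. ennreal ((norm ((T1 - T2) *v f z))\<^sup>2) \<partial>?G)"
    unfolding \<pi>_def by (subst nn_integral_distr) (auto simp: dist_norm matrix_vector_mult_diff_rdistrib)
  also have "\<dots> \<le> (\<integral>\<^sup>+ z. ennreal ((norm (T1 - T2))\<^sup>2 * trace A) * ennreal ((norm (\<chi> i. z i))\<^sup>2) \<partial>?G)"
  proof (rule nn_integral_mono)
    fix z :: "'d \<Rightarrow> real"
    have R: "(norm ?R)\<^sup>2 = trace A"
      using mat_sqrt_properties[OF A] by (simp add: norm_matrix_power2 pos_semidef_def symmetric_matrix_def)
    have "norm ((T1 - T2) *v f z) \<le> norm (T1 - T2) * (norm ?R * norm (\<chi> i. z i))"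
      unfolding f_def
      by (intro order_trans[OF norm_matrix_vector_mult_le] mult_left_mono norm_matrix_vector_mult_le) auto
    then have "(norm ((T1 - T2) *v f z))\<^sup>2 \<le> (norm (T1 - T2) * (norm ?R * norm (\<chi> i. z i)))\<^sup>2"
      by (intro power_mono) auto
    also have "\<dots> = (norm (T1 - T2))\<^sup>2 * trace A * (norm (\<chi> i. z i))\<^sup>2"
      by (simp add: power_mult_distrib R)
    finally show "ennreal ((norm ((T1 - T2) *v f z))\<^sup>2)
        \<le> ennreal ((norm (T1 - T2))\<^sup>2 * trace A) * ennreal ((norm (\<chi> i. z i))\<^sup>2)"
      by (simp add: ennreal_mult'[symmetric] trace_pos_semidef_nonneg[OF A] ennreal_leI)
  qed
  also have "\<dots> = ennreal ((norm (T1 - T2))\<^sup>2 * trace A) * ennreal (real CARD('d))"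
    by (subst nn_integral_cmult) (auto simp: nn_integral_std_gaussian_norm2)
  also have "\<dots> = ennreal ((norm (T1 - T2))\<^sup>2 * trace A * real CARD('d))"
    by (simp add: ennreal_mult'[symmetric] trace_pos_semidef_nonneg[OF A])
  finally have "enn2real (INF \<pi>\<in>couplings (linear_push T1 (centred_gaussian A)) (linear_push T2 (centred_gaussian A)).
      \<integral>\<^sup>+ z. ennreal ((dist (fst z) (snd z))\<^sup>2) \<partial>\<pi>) \<le> (norm (T1 - T2))\<^sup>2 * trace A * real CARD('d)"
    using trace_pos_semidef_nonneg[OF A] by (intro enn2real_leI) auto
  then show ?thesis unfolding wasserstein2_def by simp
qed

lemma rho_le:
  fixes P :: "(real^'d^'d) measure"
  assumes P: "prob_space P" and AE: "AE A in P. pos_semidef A \<and> trace A \<le> t" and t: "t \<ge> 0"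
  shows "rho P T1 T2 \<le> sqrt (t * real CARD('d)) * norm (T1 - T2)"
proof -
  interpret prob_space P by (rule P)
  have "(\<integral>A. (wasserstein2 (linear_push T1 (centred_gaussian A)) (linear_push T2 (centred_gaussian A)))\<^sup>2 \<partial>P)
      \<le> (\<integral>A. (norm (T1 - T2))\<^sup>2 * t * real CARD('d) \<partial>P)"
  \<comment> \<open>The comparison rests on the constant being integrable and nonnegative: a left
    integrand that failed to be integrable would have integral 0 by convention.\<close>
  proof (rule integral_mono_AE')
    show "AE A in P. (wasserstein2 (linear_push T1 (centred_gaussian A)) (linear_push T2 (centred_gaussian A)))\<^sup>2
      \<le> (norm (T1 - T2))\<^sup>2 * t * real CARD('d)"
      using AE
    proof eventually_elim
      case (elim A)
      then have "(norm (T1 - T2))\<^sup>2 * trace A * real CARD('d) \<le> (norm (T1 - T2))\<^sup>2 * t * real CARD('d)"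
        by (intro mult_right_mono mult_left_mono) auto
      with wasserstein2_linear_push_le[of A T1 T2] elim show ?case by linarith
    qed
  qed (use t in auto)
  then have "rho P T1 T2 \<le> sqrt ((norm (T1 - T2))\<^sup>2 * (t * real CARD('d)))"
    unfolding rho_def by (simp add: prob_space mult.assoc)
  also have "\<dots> = sqrt (t * real CARD('d)) * norm (T1 - T2)"
    by (simp add: real_sqrt_mult)
  finally show ?thesis .
qed

section \<open>Borel measurability of matrix conditions\<close>

lemma borel_measurable_matrix_component [measurable (raw)]:
  "f \<in> borel_measurable N \<Longrightarrow> (\<lambda>x. (f x :: real^'n^'m)$a$b) \<in> borel_measurable N"
  by (rule measurable_compose[where N = borel], assumption)
     (intro borel_measurable_continuous_onI continuous_intros)

text \<open>Symmetry, and the form inequality at each fixed \<open>x\<close>, are closed conditions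
  on the entries; an arbitrary intersection of closed sets is closed.\<close>

lemma sets_pos_semidef_diff [measurable]: "{A::real^'d^'d. pos_semidef (A - mat c)} \<in> sets borel"
proof -
  have "{A::real^'d^'d. pos_semidef (A - mat c)} =
    {A. (\<forall>i j. A$i$j = A$j$i) \<and> (\<forall>x. c * (x \<bullet> x) \<le> (\<Sum>i\<in>UNIV. x$i * (\<Sum>j\<in>UNIV. A$i$j * x$j)))}"
    unfolding pos_semidef_diff_mat_iff
    by (auto simp: symmetric_matrix_def transpose_def vec_eq_iff inner_vec_def matrix_vector_mult_def)
  also have "closed \<dots>"
    by (intro closed_Collect_conj closed_Collect_all closed_Collect_eq closed_Collect_le continuous_intros)
  finally show ?thesis by simp
qed

section \<open>Chebyshev and Markov bounds\<close>

context prob_space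
begin

text \<open>Expanding the square leaves only the \<open>n\<close> diagonal terms. Orthogonality is
  assumed because this is what \<open>expectation_noise_product_eq_0\<close> supplies.\<close>

lemma expectation_sum_orthogonal_le:
  fixes X :: "nat \<Rightarrow> 'a \<Rightarrow> real"
  assumes [measurable]: "\<And>i. X i \<in> borel_measurable M" and b: "\<And>i. AE x in M. \<bar>X i x\<bar> \<le> b"
    and orth: "\<And>i j. i \<noteq> j \<Longrightarrow> expectation (\<lambda>x. X i x * X j x) = 0"
  shows "integrable M (\<lambda>x. (\<Sum>i<n. X i x)\<^sup>2)"
    and "expectation (\<lambda>x. (\<Sum>i<n. X i x)\<^sup>2) \<le> real n * b\<^sup>2"
proof -
  have prodb: "AE x in M. \<bar>X i x * X j x\<bar> \<le> b\<^sup>2" for i j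
    using b[of i] b[of j]
  proof eventually_elim
    case (elim x)
    then show ?case unfolding abs_mult power2_eq_square by (intro mult_mono) auto
  qed
  have int: "integrable M (\<lambda>x. X i x * X j x)" for i j
    using prodb[of i j] by (intro integrable_const_bound[where B = "b\<^sup>2"]) auto
  have sq: "(\<Sum>i<n. X i x)\<^sup>2 = (\<Sum>i<n. \<Sum>j<n. X i x * X j x)" for x
    by (simp add: power2_eq_square sum_product)
  show "integrable M (\<lambda>x. (\<Sum>i<n. X i x)\<^sup>2)" unfolding sq using int by auto
  have "expectation (\<lambda>x. (\<Sum>i<n. X i x)\<^sup>2) = (\<Sum>i<n. \<Sum>j<n. expectation (\<lambda>x. X i x * X j x))"
    unfolding sq using int by simp
  also have "\<dots> = (\<Sum>i<n. \<Sum>j<n. if j = i then expectation (\<lambda>x. X i x * X i x) else 0)"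
    using orth by (intro sum.cong refl) auto
  also have "\<dots> = (\<Sum>i<n. expectation (\<lambda>x. X i x * X i x))" by simp
  also have "\<dots> \<le> (\<Sum>i<n. expectation (\<lambda>x. b\<^sup>2))"
  proof (intro sum_mono integral_mono_AE int)
    fix i show "AE x in M. X i x * X i x \<le> b\<^sup>2" using prodb[of i i] by eventually_elim simp
  qed auto
  finally show "expectation (\<lambda>x. (\<Sum>i<n. X i x)\<^sup>2) \<le> real n * b\<^sup>2" by (simp add: prob_space)
qed

text \<open>Chebyshev's inequality, obtained from Markov's inequality for the squared sum.\<close>

lemma prob_sum_orthogonal_ge:
  fixes X :: "nat \<Rightarrow> 'a \<Rightarrow> real"
  assumes X[measurable]: "\<And>i. X i \<in> borel_measurable M" and b: "\<And>i. AE x in M. \<bar>X i x\<bar> \<le> b"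
    and orth: "\<And>i j. i \<noteq> j \<Longrightarrow> expectation (\<lambda>x. X i x * X j x) = 0"
    and k: "k > 0" and n: "n \<ge> 1"
  shows "prob {x \<in> space M. \<bar>\<Sum>i<n. X i x\<bar> > k * sqrt (real n)} \<le> b\<^sup>2 / k\<^sup>2"
proof -
  have "prob {x \<in> space M. \<bar>\<Sum>i<n. X i x\<bar> > k * sqrt (real n)} \<le> prob {x \<in> space M. (\<Sum>i<n. X i x)\<^sup>2 \<ge> k\<^sup>2 * real n}"
  proof (rule finite_measure_mono)
    show "{x \<in> space M. \<bar>\<Sum>i<n. X i x\<bar> > k * sqrt (real n)} \<subseteq> {x \<in> space M. (\<Sum>i<n. X i x)\<^sup>2 \<ge> k\<^sup>2 * real n}"
    proof safe
      fix x assume "\<bar>\<Sum>i<n. X i x\<bar> > k * sqrt (real n)"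
      then have "(k * sqrt (real n))\<^sup>2 \<le> \<bar>\<Sum>i<n. X i x\<bar>\<^sup>2" using k by (intro power_mono) auto
      then show "k\<^sup>2 * real n \<le> (\<Sum>i<n. X i x)\<^sup>2" by (simp add: power_mult_distrib)
    qed
  qed measurable
  also have "\<dots> \<le> expectation (\<lambda>x. (\<Sum>i<n. X i x)\<^sup>2) / (k\<^sup>2 * real n)"
    using k n
    by (intro integral_Markov_inequality_measure[where A = "{}"] expectation_sum_orthogonal_le(1)[OF X b orth]) auto
  also have "\<dots> \<le> (real n * b\<^sup>2) / (k\<^sup>2 * real n)"
    by (intro divide_right_mono expectation_sum_orthogonal_le(2)[OF X b orth]) auto
  also have "\<dots> = b\<^sup>2 / k\<^sup>2" using n by simp
  finally show ?thesis .
qed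

text \<open>Markov's inequality for the number of events that occur, whose expectation is at most
  \<open>n p\<close>.\<close>

lemma prob_half_of_events_le:
  assumes E[measurable]: "\<And>i. E i \<in> events" and p: "\<And>i. prob (E i) \<le> p" and n: "n \<ge> 1"
  shows "prob {x \<in> space M. real n / 2 \<le> (\<Sum>i<n. indicator (E i) x)} \<le> 2 * p"
proof -
  have "prob {x \<in> space M. real n / 2 \<le> (\<Sum>i<n. indicator (E i) x)}
      \<le> expectation (\<lambda>x. \<Sum>i<n. indicator (E i) x) / (real n / 2)"
    using n by (intro integral_Markov_inequality_measure[where A = "{}"]) (auto intro!: sum_nonneg simp: emeasure_eq_measure)
  also have "expectation (\<lambda>x. \<Sum>i<n. indicator (E i) x) = (\<Sum>i<n. prob (E i))"
    by (subst Bochner_Integration.integral_sum) (auto simp: emeasure_eq_measure)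
  also have "\<dots> / (real n / 2) \<le> (\<Sum>i<n. p) / (real n / 2)"
    by (intro divide_right_mono sum_mono p) auto
  finally show ?thesis using n by simp
qed

text \<open>Continuity from above: the events \<open>S k\<close> decrease to a null set, since a
  positive definite matrix has a positive smallest eigenvalue. The bound covers all smaller
  \<open>\<delta>\<close>, so that one value can later serve several matrices.\<close>

lemma pos_def_lower_prob:
  fixes X :: "'a \<Rightarrow> real^'d^'d"
  assumes [measurable]: "X \<in> borel_measurable M" and pd: "AE x in M. pos_def (X x)" and \<eta>: "\<eta> > 0"
  shows "\<exists>\<delta>0>0. \<forall>\<delta>. 0 < \<delta> \<and> \<delta> \<le> \<delta>0 \<longrightarrow> prob {x \<in> space M. \<not> pos_semidef (X x - mat \<delta>)} \<le> \<eta>"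
proof -
  define S where "S k = {x \<in> space M. \<not> pos_semidef (X x - mat (1 / real (Suc k)))}" for k
  have [measurable]: "{x \<in> space M. \<not> pos_semidef (X x - mat c)} \<in> events" for c
  proof -
    have "{x \<in> space M. \<not> pos_semidef (X x - mat c)} = space M - X -` {A. pos_semidef (A - mat c)} \<inter> space M" by auto
    then show ?thesis using measurable_sets[OF assms(1) sets_pos_semidef_diff] by auto
  qed
  have S[measurable]: "S k \<in> events" for k unfolding S_def by measurable
  have "decseq S"
  proof (rule decseq_SucI)
    fix k show "S (Suc k) \<subseteq> S k"
      unfolding S_def using pos_semidef_diff_mono[of _ "1 / real (Suc k)" "1 / real (Suc (Suc k))"]
      by (auto simp: frac_le)
  qed
  then have lim: "(\<lambda>k. prob (S k)) \<longlonglongrightarrow> prob (\<Inter>k. S k)"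
    by (intro finite_Lim_measure_decseq) (auto simp: S)
  have "AE x in M. x \<notin> (\<Inter>k. S k)"
    using pd
  proof eventually_elim
    case (elim x)
    obtain \<delta> where \<delta>: "\<delta> > 0" "pos_semidef (X x - mat \<delta>)" using pos_def_lower[OF elim] by blast
    obtain k where "1 / real (Suc k) < \<delta>" using nat_approx_posE[OF \<delta>(1)] by blast
    then have "x \<notin> S k" using pos_semidef_diff_mono[OF \<delta>(2), of "1 / real (Suc k)"] by (auto simp: S_def)
    then show ?case by blast
  qed
  then have "prob (\<Inter>k. S k) = 0"
    by (intro prob_eq_0[THEN iffD2]) auto
  with lim have "eventually (\<lambda>k. prob (S k) < \<eta>) sequentially"
    using \<eta> by (intro order_tendstoD(2)) auto
  then obtain k where k: "prob (S k) < \<eta>" by (auto simp: eventually_sequentially)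
  show ?thesis
  proof (intro exI[of _ "1 / real (Suc k)"] conjI allI impI)
    fix \<delta> :: real assume \<delta>: "0 < \<delta> \<and> \<delta> \<le> 1 / real (Suc k)"
    have "prob {x \<in> space M. \<not> pos_semidef (X x - mat \<delta>)} \<le> prob (S k)"
      using pos_semidef_diff_mono[of _ "1 / real (Suc k)" \<delta>] \<delta> by (intro finite_measure_mono) (auto simp: S_def)
    with k show "prob {x \<in> space M. \<not> pos_semidef (X x - mat \<delta>)} \<le> \<eta>" by simp
  qed simp
qed

text \<open>\<open>R\<close> stands for the covariance matrices, as \<open>M\<close> names the
  measure here. Independence of the two sequences splits off the expectation of the product of the
  noise entries, and independence of \<open>Q i\<close> and \<open>Q j\<close> makes that a product
  of two zero means.\<close>

lemma expectation_noise_product_eq_0: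
  fixes Q R :: "nat \<Rightarrow> 'a \<Rightarrow> real^'d^'d"
  assumes indQ: "indep_vars (\<lambda>_. borel) Q UNIV"
    and indQR: "indep_var (PiM UNIV (\<lambda>_. borel)) (\<lambda>\<omega> i. Q i \<omega>) (PiM UNIV (\<lambda>_. borel)) (\<lambda>\<omega> i. R i \<omega>)"
    and mQ[measurable]: "\<And>i. Q i \<in> borel_measurable M" and mR[measurable]: "\<And>i. R i \<in> borel_measurable M"
    and bQ: "\<And>i. AE \<omega> in M. norm (Q i \<omega>) \<le> \<beta>" and bR: "\<And>i. AE \<omega> in M. norm (R i \<omega>) \<le> \<beta>"
    and EQ: "\<And>i. integral\<^sup>L M (Q i) = mat 1"
    and ij: "i \<noteq> j"
  shows "expectation (\<lambda>\<omega>. ((mat 1 - Q i \<omega>)$a$b * R i \<omega>$c$e) * ((mat 1 - Q j \<omega>)$a$b * R j \<omega>$c$e)) = 0"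
proof -
  have int: "integrable M (Q k)" for k
    using bQ[of k] by (intro integrable_const_bound[where B = \<beta>]) auto
  define q where "q k \<omega> = (mat 1 - Q k \<omega>)$a$b" for k \<omega>
  have [measurable]: "q k \<in> borel_measurable M" for k unfolding q_def by measurable
  have bl: "bounded_linear (\<lambda>A::real^'d^'d. A$a$b)"
    by (rule bounded_linear_compose[OF bounded_linear_vec_nth bounded_linear_vec_nth])
  have intq: "integrable M (q k)" for k
    unfolding q_def using integrable_bounded_linear[OF bl int[of k]] by simp
  have Eq: "expectation (q k) = 0" for k
    unfolding q_def using integrable_bounded_linear[OF bl int[of k]] integral_bounded_linear[OF bl int[of k]] EQ[of k]
    by (simp add: prob_space)
  have qb: "AE \<omega> in M. \<bar>q k \<omega>\<bar> \<le> norm (mat 1 :: real^'d^'d) + \<beta>" for k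
    using bQ[of k]
  proof eventually_elim
    case (elim \<omega>)
    have "\<bar>q k \<omega>\<bar> \<le> norm (mat 1 - Q k \<omega>)" unfolding q_def by (rule abs_matrix_component_le)
    then show ?case using elim norm_triangle_ineq4[of "mat 1" "Q k \<omega>"] by linarith
  qed
  have rb: "AE \<omega> in M. \<bar>R k \<omega>$c$e\<bar> \<le> \<beta>" for k
    using bR[of k] by eventually_elim (rule order_trans[OF abs_matrix_component_le])
  \<comment> \<open>Pairwise independence is read off from restrictions of the family to the
    disjoint index sets \<open>{i}\<close> and \<open>{j}\<close>.\<close>
  have "indep_var borel ((\<lambda>f. (mat 1 - f i)$a$b) \<circ> (\<lambda>\<omega>. restrict (\<lambda>i. Q i \<omega>) {i}))
          borel ((\<lambda>f. (mat 1 - f j)$a$b) \<circ> (\<lambda>\<omega>. restrict (\<lambda>i. Q i \<omega>) {j}))"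
    by (rule indep_var_compose[OF indep_var_restrict[OF indQ]]) (use ij in auto)
  then have "indep_var borel (q i) borel (q j)" by (simp add: comp_def q_def[abs_def])
  from indep_var_lebesgue_integral[OF this intq intq]
  have Eqq: "expectation (\<lambda>\<omega>. q i \<omega> * q j \<omega>) = 0" by (simp add: Eq)
  have "indep_var borel ((\<lambda>f. (mat 1 - f i)$a$b * (mat 1 - f j)$a$b) \<circ> (\<lambda>\<omega> i. Q i \<omega>))
          borel ((\<lambda>f. f i$c$e * f j$c$e) \<circ> (\<lambda>\<omega> i. R i \<omega>))"
    by (rule indep_var_compose[OF indQR]) measurable
  then have ind: "indep_var borel (\<lambda>\<omega>. q i \<omega> * q j \<omega>) borel (\<lambda>\<omega>. R i \<omega>$c$e * R j \<omega>$c$e)"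
    by (simp add: comp_def q_def)
  have "AE \<omega> in M. norm (q i \<omega> * q j \<omega>) \<le> (norm (mat 1 :: real^'d^'d) + \<beta>)\<^sup>2"
    using qb[of i] qb[of j]
    by eventually_elim (auto simp: abs_mult power2_eq_square intro!: mult_mono)
  then have i1: "integrable M (\<lambda>\<omega>. q i \<omega> * q j \<omega>)" by (intro integrable_const_bound) auto
  have "AE \<omega> in M. norm (R i \<omega>$c$e * R j \<omega>$c$e) \<le> \<beta>\<^sup>2"
    using rb[of i] rb[of j]
    by eventually_elim (auto simp: abs_mult power2_eq_square intro!: mult_mono)
  then have i2: "integrable M (\<lambda>\<omega>. R i \<omega>$c$e * R j \<omega>$c$e)" by (intro integrable_const_bound) auto
  have "expectation (\<lambda>\<omega>. (q i \<omega> * q j \<omega>) * (R i \<omega>$c$e * R j \<omega>$c$e)) = 0"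
    using indep_var_lebesgue_integral[OF ind i1 i2] Eqq by simp
  then show ?thesis by (simp add: q_def mult_ac)
qed

end

section \<open>Assembly of the stochastic bounds\<close>

lemma prob_eq_of_distr_eq:
  assumes "distr M N X = distr M N Y" "X \<in> measurable M N" "Y \<in> measurable M N" "{x. P x} \<in> sets N"
  shows "measure M {\<omega> \<in> space M. P (X \<omega>)} = measure M {\<omega> \<in> space M. P (Y \<omega>)}"
proof -
  have "measure M {\<omega> \<in> space M. P (Z \<omega>)} = measure (distr M N Z) {x. P x}" if "Z \<in> measurable M N" for Z
    using that assms(4) by (subst measure_distr) (auto intro: arg_cong[where f = "measure M"])
  then show ?thesis using assms by metis
qed

theorem theorem6p3:
  fixes \<Omega> :: "'w measure"
    and L :: real
    and T0 :: "real^'d^'d"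
    and M N Q :: "nat \<Rightarrow> 'w \<Rightarrow> real^'d^'d"
    and That :: "nat \<Rightarrow> 'w \<Rightarrow> real^'d^'d"
  assumes "prob_space \<Omega>"
    and "L > 0"
    and "T0 \<in> spd_set L"
    and "iid \<Omega> (borel \<Otimes>\<^sub>M borel) (\<lambda>i \<omega>. (M i \<omega>, N i \<omega>))"
    and "\<And>i. AE \<omega> in \<Omega>. M i \<omega> \<in> spd_set L"
    and "\<And>i. AE \<omega> in \<Omega>. N i \<omega> = Q i \<omega> ** T0 ** M i \<omega> ** T0 ** Q i \<omega>"
    and "iid \<Omega> borel Q"
    and "\<And>i. AE \<omega> in \<Omega>. Q i \<omega> \<in> spd_set L"
    and "prob_space.indep_var \<Omega> (PiM UNIV (\<lambda>_. borel)) (\<lambda>\<omega> i. Q i \<omega>)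
           (PiM UNIV (\<lambda>_. borel)) (\<lambda>\<omega> i. M i \<omega>)"
    and "\<And>i. integral\<^sup>L \<Omega> (Q i) = mat 1"
    and "\<And>n. n \<ge> 1 \<Longrightarrow> That n \<in> borel_measurable \<Omega>"
    and "\<And>n. n \<ge> 1 \<Longrightarrow> AE \<omega> in \<Omega>.
           is_arg_min (objective (\<lambda>i. M i \<omega>) (\<lambda>i. N i \<omega>) n) (\<lambda>T. T \<in> spd_set L) (That n \<omega>)"
  shows "bounded_in_prob \<Omega>
           (\<lambda>n \<omega>. sqrt (real n) * rho (distr \<Omega> borel (M 0)) (That n \<omega>) T0)"
proof -
  interpret prob_space \<Omega> by fact
  note L = assms(2) and T0 = assms(3)
  define d where "d = real CARD('d)"
  define \<beta> where "\<beta> = L * d"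
  have d: "d > 0" and \<beta>: "\<beta> > 0" using L by (auto simp: d_def \<beta>_def)
  have indQ: "indep_vars (\<lambda>_. borel) Q UNIV" using assms(7) by (simp add: iid_def)
  have mQ[measurable]: "Q i \<in> borel_measurable \<Omega>" for i using indQ by (simp add: indep_vars_def)
  have mMN: "(\<lambda>\<omega>. (M i \<omega>, N i \<omega>)) \<in> measurable \<Omega> (borel \<Otimes>\<^sub>M borel)" for i
    using assms(4) by (simp add: indep_vars_def iid_def)
  have mM[measurable]: "M i \<in> borel_measurable \<Omega>" for i
    using measurable_compose[OF mMN measurable_fst] by simp
  \<comment> \<open>The common law of the pairs is projected to the first component.\<close>
  have dM: "distr \<Omega> borel (M i) = distr \<Omega> borel (M 0)" for i
  proof -
    have fst: "distr \<Omega> borel (M j) = distr (distr \<Omega> (borel \<Otimes>\<^sub>M borel) (\<lambda>\<omega>. (M j \<omega>, N j \<omega>))) borel fst" for j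
      using mMN by (subst distr_distr) (auto simp: comp_def)
    have "distr \<Omega> (borel \<Otimes>\<^sub>M borel) (\<lambda>\<omega>. (M i \<omega>, N i \<omega>)) = distr \<Omega> (borel \<Otimes>\<^sub>M borel) (\<lambda>\<omega>. (M 0 \<omega>, N 0 \<omega>))"
      using assms(4) unfolding iid_def by blast
    then show ?thesis unfolding fst[of i] fst[of 0] by (rule arg_cong)
  qed
  have dQ: "distr \<Omega> borel (Q i) = distr \<Omega> borel (Q 0)" for i using assms(7) by (simp add: iid_def)
  have spd_norm: "norm A \<le> \<beta>" if "A \<in> spd_set L" for A :: "real^'d^'d"
    using norm_spd_set_le[OF that L] by (simp add: \<beta>_def d_def)
  have bM: "AE \<omega> in \<Omega>. norm (M i \<omega>) \<le> \<beta>" for i using assms(5)[of i] by eventually_elim (rule spd_norm)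
  have bQ: "AE \<omega> in \<Omega>. norm (Q i \<omega>) \<le> \<beta>" for i using assms(8)[of i] by eventually_elim (rule spd_norm)

  \<comment> \<open>Bounds the trace of a covariance matrix, by Cauchy-Schwarz against the
    identity.\<close>
  define t where "t = norm (mat 1 :: real^'d^'d) * \<beta>"
  define C where "C = sqrt (t * d)"
  have rho: "rho (distr \<Omega> borel (M 0)) T1 T2 \<le> C * norm (T1 - T2)" for T1 T2 :: "real^'d^'d"
    unfolding C_def d_def
  proof (rule rho_le)
    have "AE \<omega> in \<Omega>. pos_semidef (M 0 \<omega>) \<and> trace (M 0 \<omega>) \<le> t"
      using assms(5)[of 0]
    proof eventually_elim
      case (elim \<omega>)
      have "trace (M 0 \<omega>) = mat 1 \<bullet> M 0 \<omega>" by (simp add: inner_matrix_eq_trace)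
      also have "\<dots> \<le> norm (mat 1 :: real^'d^'d) * norm (M 0 \<omega>)" by (rule norm_cauchy_schwarz)
      also have "\<dots> \<le> t" unfolding t_def using spd_norm[OF elim] by (intro mult_left_mono) auto
      finally show ?case using elim by (simp add: spd_set_def pos_def_imp_pos_semidef)
    qed
    \<comment> \<open>Subtracting \<open>mat 0\<close> brings the condition into the form whose
      measurability is given by \<open>sets_pos_semidef_diff\<close>.\<close>
    then have "AE \<omega> in \<Omega>. pos_semidef (M 0 \<omega> - mat 0) \<and> trace (M 0 \<omega>) \<le> t" by simp
    then have "AE A in distr \<Omega> borel (M 0). pos_semidef (A - mat 0) \<and> trace A \<le> t"
    proof (subst AE_distr_iff)
      have "closed {A :: real^'d^'d. trace A \<le> t}"
        unfolding trace_def by (intro closed_Collect_le continuous_intros)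
      then have "{A :: real^'d^'d. pos_semidef (A - mat 0)} \<inter> {A. trace A \<le> t} \<in> sets borel"
        by (intro sets.Int sets_pos_semidef_diff) auto
      then show "{A \<in> space borel. pos_semidef (A - mat 0) \<and> trace (A :: real^'d^'d) \<le> t} \<in> sets borel"
        by (simp add: Int_def)
    qed auto
    then show "AE A in distr \<Omega> borel (M 0). pos_semidef A \<and> trace A \<le> t" by simp
  qed (use \<beta> in \<open>auto simp: t_def intro: prob_space_distr\<close>)
  have rho0: "rho (distr \<Omega> borel (M 0)) T1 T2 \<ge> 0" for T1 T2 :: "real^'d^'d"
    unfolding rho_def by simp
  have C0: "C \<ge> 0" using \<beta> d by (simp add: C_def t_def)

  show ?thesis unfolding bounded_in_prob_def
  proof (intro allI impI)
    fix \<epsilon> :: real assume \<epsilon>: "\<epsilon> > 0"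
    \<comment> \<open>Each sample is ill-conditioned through \<open>M\<close> or \<open>Q\<close>
      with probability at most \<open>2 * \<eta>\<close>, and Markov's inequality doubles this: the
      total \<open>4 * \<eta>\<close> is half of \<open>\<epsilon>\<close>. The other half is left
      to the fluctuations.\<close>
    define \<eta> where "\<eta> = \<epsilon> / 8"
    have \<eta>: "\<eta> > 0" using \<epsilon> by (simp add: \<eta>_def)
    have "AE \<omega> in \<Omega>. pos_def (M 0 \<omega>)" "AE \<omega> in \<Omega>. pos_def (Q 0 \<omega>)"
      using assms(5)[of 0] assms(8)[of 0] by (auto simp: spd_set_def)
    then obtain \<delta>1 \<delta>2 where \<delta>1: "\<delta>1 > 0" "\<And>\<delta>. 0 < \<delta> \<Longrightarrow> \<delta> \<le> \<delta>1 \<Longrightarrow> prob {\<omega> \<in> space \<Omega>. \<not> pos_semidef (M 0 \<omega> - mat \<delta>)} \<le> \<eta>"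
      and \<delta>2: "\<delta>2 > 0" "\<And>\<delta>. 0 < \<delta> \<Longrightarrow> \<delta> \<le> \<delta>2 \<Longrightarrow> prob {\<omega> \<in> space \<Omega>. \<not> pos_semidef (Q 0 \<omega> - mat \<delta>)} \<le> \<eta>"
      using pos_def_lower_prob[OF mM _ \<eta>, of 0] pos_def_lower_prob[OF mQ _ \<eta>, of 0] by blast
    obtain \<delta>3 where \<delta>3: "\<delta>3 > 0" "pos_semidef (T0 - mat \<delta>3)"
      using pos_def_lower[of T0] T0 by (auto simp: spd_set_def)
    define \<delta> where "\<delta> = min \<delta>1 (min \<delta>2 \<delta>3)"
    have \<delta>: "\<delta> > 0" using \<delta>1 \<delta>2 \<delta>3 by (simp add: \<delta>_def)
    have T0\<delta>: "pos_semidef (T0 - mat \<delta>)"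
      by (rule pos_semidef_diff_mono[OF \<delta>3(2)]) (simp add: \<delta>_def)
    obtain \<kappa> where \<kappa>: "\<kappa> > 0" "\<And>M Q T. M \<in> spd_set L \<Longrightarrow> Q \<in> spd_set L \<Longrightarrow> T \<in> spd_set L \<Longrightarrow>
        pos_semidef (M - mat \<delta>) \<Longrightarrow> pos_semidef (Q - mat \<delta>) \<Longrightarrow>
        trace ((mat 1 - Q) ** (T ** M ** T - T0 ** M ** T0)) + \<kappa> * (norm (T - T0))\<^sup>2
        \<le> loss M (Q ** T0 ** M ** T0 ** Q) T - loss M (Q ** T0 ** M ** T0 ** Q) T0"
      using loss_quadratic_lower_bound[OF L T0 \<delta> T0\<delta>] by metis
    define x where "x a b c e i \<omega> = (mat 1 - Q i \<omega>)$a$b * M i \<omega>$c$e" for a b c e i \<omega>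
    have [measurable]: "x a b c e i \<in> borel_measurable \<Omega>" for a b c e i unfolding x_def by measurable
    define xb where "xb = (norm (mat 1 :: real^'d^'d) + \<beta>) * \<beta>"
    have xb: "xb > 0" using \<beta> by (simp add: xb_def add_nonneg_pos)
    have x_bound: "AE \<omega> in \<Omega>. \<bar>x a b c e i \<omega>\<bar> \<le> xb" for a b c e i
      using bM[of i] bQ[of i]
    proof eventually_elim
      case (elim \<omega>)
      have "\<bar>(mat 1 - Q i \<omega>)$a$b\<bar> \<le> norm (mat 1 :: real^'d^'d) + \<beta>"
        using abs_matrix_component_le[of "mat 1 - Q i \<omega>" a b] norm_triangle_ineq4[of "mat 1" "Q i \<omega>"] elim
        by linarith
      moreover have "\<bar>M i \<omega>$c$e\<bar> \<le> \<beta>" using abs_matrix_component_le[of "M i \<omega>" c e] elim by linarith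
      ultimately show ?case unfolding x_def xb_def abs_mult by (intro mult_mono) auto
    qed
    have x_orth: "expectation (\<lambda>\<omega>. x a b c e i \<omega> * x a b c e j \<omega>) = 0" if "i \<noteq> j" for a b c e i j
      unfolding x_def by (rule expectation_noise_product_eq_0[OF indQ assms(9) mQ mM bQ bM assms(10) that])
    \<comment> \<open>Chosen so that the Chebyshev bounds \<open>xb\<^sup>2 / k\<^sup>2\<close>,
      summed over the \<open>d^4\<close> index quadruples, give
      \<open>\<epsilon> / 2\<close>.\<close>
    define k where "k = sqrt (2 * d^4 * xb\<^sup>2 / \<epsilon>)"
    have k: "k > 0" "k\<^sup>2 = 2 * d^4 * xb\<^sup>2 / \<epsilon>" using d xb \<epsilon> by (simp_all add: k_def)
    \<comment> \<open>The bound of \<open>minimizer_error_bound\<close> times the factor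
      \<open>C\<close> that converts the Frobenius norm to \<open>rho\<close>.\<close>
    define K where "K = C * (4 * d^4 * k * \<beta> / \<kappa>)"
    have K0: "K \<ge> 0" using C0 d k \<beta> \<kappa>(1) by (simp add: K_def)

    have meas\<delta>: "{\<omega> \<in> space \<Omega>. \<not> pos_semidef (X \<omega> - mat \<delta>)} \<in> events"
      if [measurable]: "X \<in> borel_measurable \<Omega>" for X :: "'w \<Rightarrow> real^'d^'d"
    proof -
      have "{\<omega> \<in> space \<Omega>. \<not> pos_semidef (X \<omega> - mat \<delta>)} = space \<Omega> - X -` {A. pos_semidef (A - mat \<delta>)} \<inter> space \<Omega>" by auto
      then show ?thesis using measurable_sets[OF that sets_pos_semidef_diff] by auto
    qed
    define E where "E i = {\<omega> \<in> space \<Omega>. \<not> pos_semidef (M i \<omega> - mat \<delta>)} \<union> {\<omega> \<in> space \<Omega>. \<not> pos_semidef (Q i \<omega> - mat \<delta>)}" for i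
    have E: "E i \<in> events" for i unfolding E_def by (intro sets.Un meas\<delta> mM mQ)
    have pE: "prob (E i) \<le> 2 * \<eta>" for i
    proof -
      have S: "{A::real^'d^'d. \<not> pos_semidef (A - mat \<delta>)} \<in> sets borel"
        using sets.compl_sets[OF sets_pos_semidef_diff[of \<delta>]] by (simp add: Collect_neg_eq Compl_eq_Diff_UNIV)
      have "prob (E i) \<le> prob {\<omega> \<in> space \<Omega>. \<not> pos_semidef (M i \<omega> - mat \<delta>)} + prob {\<omega> \<in> space \<Omega>. \<not> pos_semidef (Q i \<omega> - mat \<delta>)}"
        unfolding E_def by (intro measure_Un_le meas\<delta> mM mQ)
      also have "\<dots> = prob {\<omega> \<in> space \<Omega>. \<not> pos_semidef (M 0 \<omega> - mat \<delta>)} + prob {\<omega> \<in> space \<Omega>. \<not> pos_semidef (Q 0 \<omega> - mat \<delta>)}"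
        using prob_eq_of_distr_eq[OF dM mM mM S, of i] prob_eq_of_distr_eq[OF dQ mQ mQ S, of i] by simp
      also have "\<dots> \<le> \<eta> + \<eta>" using \<delta> by (intro add_mono \<delta>1 \<delta>2) (auto simp: \<delta>_def)
      finally show ?thesis by simp
    qed
    show "\<exists>K. \<forall>n. prob {\<omega> \<in> space \<Omega>. K < \<bar>sqrt (real n) * rho (distr \<Omega> borel (M 0)) (That n \<omega>) T0\<bar>} \<le> \<epsilon>"
    proof (intro exI[of _ K] allI)
      fix n
      show "prob {\<omega> \<in> space \<Omega>. K < \<bar>sqrt (real n) * rho (distr \<Omega> borel (M 0)) (That n \<omega>) T0\<bar>} \<le> \<epsilon>"
      proof (cases "n \<ge> 1")
        case False
        then have "n = 0" by simp
        \<comment> \<open>For \<open>n = 0\<close> the factor \<open>sqrt 0\<close> vanishes, and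
          \<open>K\<close> is nonnegative, so the event is empty.\<close>
        then show ?thesis using K0 \<epsilon> by simp
      next
        case n: True
        \<comment> \<open>The two bad events: \<open>H\<close>, at least half of the samples are
          ill-conditioned; \<open>F\<close>, some entrywise noise sum is large.\<close>
        define H where "H = {\<omega> \<in> space \<Omega>. real n / 2 \<le> (\<Sum>i<n. indicator (E i) \<omega>)}"
        define F where "F = (\<lambda>(a, b, c, e). {\<omega> \<in> space \<Omega>. \<bar>\<Sum>i<n. x a b c e i \<omega>\<bar> > k * sqrt (real n)})"
        have H: "H \<in> events" unfolding H_def using E by measurable
        have F: "F p \<in> events" for p unfolding F_def by (cases p) simp
        have "prob H \<le> 2 * (2 * \<eta>)" unfolding H_def by (rule prob_half_of_events_le[OF E pE n])
        moreover have "prob (\<Union>p\<in>UNIV. F p) \<le> (\<Sum>p\<in>UNIV. prob (F p))"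
          by (intro finite_measure_subadditive_finite) (auto simp: F)
        moreover have "(\<Sum>p\<in>UNIV. prob (F p)) \<le> (\<Sum>p\<in>(UNIV :: ('d \<times> 'd \<times> 'd \<times> 'd) set). xb\<^sup>2 / k\<^sup>2)"
          by (intro sum_mono)
             (auto simp: F_def intro!: prob_sum_orthogonal_ge x_bound x_orth k(1) n split: prod.split)
        moreover have "(\<Sum>p\<in>(UNIV :: ('d \<times> 'd \<times> 'd \<times> 'd) set). xb\<^sup>2 / k\<^sup>2) = d^4 * (xb\<^sup>2 / k\<^sup>2)"
          by (simp add: d_def card_prod power4_eq_xxxx UNIV_Times_UNIV[symmetric] card_cartesian_product del: UNIV_Times_UNIV)
        moreover have "d^4 * (xb\<^sup>2 / k\<^sup>2) = \<epsilon> / 2" using d xb \<epsilon> by (simp add: k(2))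
        moreover have "prob (H \<union> (\<Union>p\<in>UNIV. F p)) \<le> prob H + prob (\<Union>p\<in>UNIV. F p)"
          by (intro measure_Un_le H) (auto intro: F)
        ultimately have pbad: "prob (H \<union> (\<Union>p\<in>UNIV. F p)) \<le> \<epsilon>" unfolding \<eta>_def by linarith

        have "AE \<omega> in \<Omega>. \<forall>i. M i \<omega> \<in> spd_set L \<and> Q i \<omega> \<in> spd_set L \<and> N i \<omega> = Q i \<omega> ** T0 ** M i \<omega> ** T0 ** Q i \<omega>"
          unfolding AE_all_countable using assms(5,6,8) by auto
        then have "AE \<omega> in \<Omega>. \<omega> \<in> {\<omega> \<in> space \<Omega>. K < \<bar>sqrt (real n) * rho (distr \<Omega> borel (M 0)) (That n \<omega>) T0\<bar>}
            \<longrightarrow> \<omega> \<in> H \<union> (\<Union>p\<in>UNIV. F p)"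
          using assms(12)[OF n]
        proof eventually_elim
          case (elim \<omega>)
          have "\<not> K < \<bar>sqrt (real n) * rho (distr \<Omega> borel (M 0)) (That n \<omega>) T0\<bar>"
            if \<omega>: "\<omega> \<in> space \<Omega>" "\<omega> \<notin> H" "\<omega> \<notin> (\<Union>p\<in>UNIV. F p)"
          proof -
            have N: "(\<lambda>i. N i \<omega>) = (\<lambda>i. Q i \<omega> ** T0 ** M i \<omega> ** T0 ** Q i \<omega>)" using elim(1) by auto
            have That: "That n \<omega> \<in> spd_set L" using elim(2) by (simp add: is_arg_min_def)
            have "sqrt (real n) * norm (That n \<omega> - T0) \<le> 4 * real CARD('d)^4 * k * (L * real CARD('d)) / \<kappa>"
            proof (rule minimizer_error_bound[where M = "\<lambda>i. M i \<omega>" and Q = "\<lambda>i. Q i \<omega>" and \<delta> = \<delta>])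
              show "objective (\<lambda>i. M i \<omega>) (\<lambda>i. Q i \<omega> ** T0 ** M i \<omega> ** T0 ** Q i \<omega>) n (That n \<omega>)
                \<le> objective (\<lambda>i. M i \<omega>) (\<lambda>i. Q i \<omega> ** T0 ** M i \<omega> ** T0 ** Q i \<omega>) n T0"
                using elim(2) T0 unfolding is_arg_min_def N by (meson not_less)
              show "\<bar>\<Sum>i<n. (mat 1 - Q i \<omega>)$a$b * M i \<omega>$c$e\<bar> \<le> k * sqrt (real n)" for a b c e
              proof -
                have "\<omega> \<notin> F (a, b, c, e)" using \<omega>(3) by blast
                then show ?thesis using \<omega>(1) by (simp add: F_def x_def)
              qed
              let ?I = "{i. i < n \<and> pos_semidef (M i \<omega> - mat \<delta>) \<and> pos_semidef (Q i \<omega> - mat \<delta>)}"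
              \<comment> \<open>Every index is either ill-conditioned or in \<open>?I\<close>, so
                the two counts add up to \<open>n\<close>; outside \<open>H\<close> the first is
                below \<open>n / 2\<close>.\<close>
              have "(\<Sum>i<n. indicator (E i) \<omega> :: real) + real (card ?I)
                  = (\<Sum>i<n. indicator (E i) \<omega>) + (\<Sum>i<n. indicator ?I i)"
                by (simp add: indicator_def sum.If_cases Int_def conj_commute)
              also have "\<dots> = (\<Sum>i<n. 1 :: real)"
                unfolding sum.distrib[symmetric] using \<omega>(1)
                by (intro sum.cong refl) (auto simp: indicator_def E_def)
              finally show "real n / 2 \<le> real (card ?I)"
                using \<omega>(1,2) by (simp add: H_def)
            qed (use L T0 That elim(1) \<kappa> n in auto)
            then have "C * (sqrt (real n) * norm (That n \<omega> - T0)) \<le> K"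
              unfolding K_def d_def \<beta>_def using C0 by (rule mult_left_mono)
            moreover have "sqrt (real n) * rho (distr \<Omega> borel (M 0)) (That n \<omega>) T0
                \<le> sqrt (real n) * (C * norm (That n \<omega> - T0))"
              by (intro mult_left_mono rho) simp
            ultimately show ?thesis using rho0 by (simp add: abs_mult mult_ac)
          qed
          then show ?case by blast
        qed
        \<comment> \<open>Monotonicity asks only the larger set to be an event; a non-measurable set
          would have measure 0 by convention.\<close>
        then have "prob {\<omega> \<in> space \<Omega>. K < \<bar>sqrt (real n) * rho (distr \<Omega> borel (M 0)) (That n \<omega>) T0\<bar>}
            \<le> prob (H \<union> (\<Union>p\<in>UNIV. F p))"
          by (rule finite_measure_mono_AE) (use H F in auto)
        with pbad show ?thesis by linarith
      qed
    qed
  qed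
qed

end
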